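(* Let $\mathcal{C}=\mathrm{Free}(G_1,G_2,\ldots,G_s)$ be a class of graphs with finite distinguishing number and let $m=\max\{|V(G_i)|:1\le i\le s\}$. Let $\ell(m)=f(M,M,M)$ with $M=R_4(2m-1)$. If $\mathcal{C}$ is above the Bell numbers then it contains a class $\mathcal{P}(w,H)$, where $H$ is a finite graph with loops allowed and $w$ is an infinite periodic word over $V(H)$ on at most $\ell(m)$ letters and with period $p(m)\le \ell(m)^m+1$.
   Context: Graphs (other than $H$) are finite and simple. $\mathrm{Free}(G_1,\dots,G_s)$ is the class of all graphs containing none of $G_1,\dots,G_s$ as an induced subgraph; a (hereditary) class is a collection of graphs closed under isomorphism and induced subgraphs. Numbers: $R_4(k)=R(k,k,k,k)$ is the 4-colour Ramsey number. $f(p,q,r)$ is a number (which exists for all $p,q,r\in\mathbb{N}$) such that every bipartite graph in which one part has $f(p,q,r)$ vertices with pairwise distinct neighbourhoods contains a $p$-matching, a $q$-comatching or an $r$-halfgraph as an induced subgraph. Here an $r$-matching, $r$-comatching, $r$-halfgraph is the bipartite graph with parts $\{x_1,\dots,x_r\}$, $\{y_1,\dots,y_r\}$ with $x_i$ adjacent to $y_j$ if and only if $i=j$, $i\neq j$, $j\le i$, respectively. Bell numbers: let $\mathcal{C}^n$ be the set of graphs in $\mathcal{C}$ with vertex set $\{1,\dots,n\}$ and $\mathcal{B}_n$ the $n$th Bell number. $\mathcal{C}$ is above the Bell numbers if there is $N\ge 1$ with $|\mathcal{C}^n|\ge\mathcal{B}_n$ for all $n\ge N$. Distinguishing number: for a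 graph $G$ and $X\subseteq V(G)$, pairwise disjoint subsets $U_1,\dots,U_p$ of $V(G)$ are distinguished by $X$ if for each $i$ all vertices of $U_i$ have the same neighbourhood in $X$, and for $i\ne j$ vertices $x\in U_i$, $y\in U_j$ have different neighbourhoods in $X$ ($X$ need not be disjoint from the $U_i$). $\mathcal{C}$ has infinite distinguishing number if for all $k,\ell\in\mathbb{N}$ there are $G\in\mathcal{C}$ and $X\subseteq V(G)$ distinguishing at least $\ell$ sets, each of size at least $k$; otherwise it has finite distinguishing number. The class $\mathcal{P}(w,H)$: let $w=w_1w_2\cdots$ be an infinite word over $V(H)$. For positive integers $i_1<\cdots<i_k$, $G_{w,H}(i_1,\dots,i_k)$ is the graph with vertex set $\{i_1,\dots,i_k\}$ in which distinct $i_j,i_{j'}$ are adjacent if and only if either $|i_j-i_{j'}|=1$ and $w_{i_j}w_{i_{j'}}\notin E(H)$, or $|i_j-i_{j'}|>1$ and $w_{i_j}w_{i_{j'}}\in E(H)$ (when the two letters coincide, this refers to the presence of a loop). $\mathcal{P}(w,H)$ is the hereditary class of all graphs isomorphic to some $G_{w,H}(i_1,\dots,i_k)$. The word $w$ is periodic with period $c\geq 1$ if $w_i=w_{i+c}$ for all $i\ge1$. *)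

theory Defs
  imports "HOL-Library.Ramsey" "HOL-Library.Disjoint_Sets"
begin

text \<open>A graph is its vertex set together with its set of edges, an edge being the set of its
  end points; a singleton edge is a loop. Two graphs on the same vertex set are therefore equal
  exactly when they have the same edges, so labelled graphs can be counted directly.\<close>

type_synonym 'a graph = "'a set \<times> 'a set set"

abbreviation verts :: "'a graph \<Rightarrow> 'a set" where "verts \<equiv> fst"
abbreviation edges :: "'a graph \<Rightarrow> 'a set set" where "edges \<equiv> snd"

definition simple_graph :: "'a graph \<Rightarrow> bool" where
  "simple_graph G \<longleftrightarrow> finite (verts G) \<and> (\<forall>e\<in>edges G. e \<subseteq> verts G \<and> card e = 2)"

definition loop_graph :: "'a graph \<Rightarrow> bool" where
  "loop_graph H \<longleftrightarrow> finite (verts H) \<and> (\<forall>e\<in>edges H. e \<subseteq> verts H \<and> card e \<in> {1, 2})"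

definition nbhd :: "'a graph \<Rightarrow> 'a \<Rightarrow> 'a set" where
  "nbhd G x = {y \<in> verts G. {x, y} \<in> edges G}"

definition graph_iso :: "'a graph \<Rightarrow> 'b graph \<Rightarrow> bool" where
  "graph_iso G G' \<longleftrightarrow> (\<exists>\<phi>. bij_betw \<phi> (verts G) (verts G') \<and>
     (\<forall>x\<in>verts G. \<forall>y\<in>verts G. {x, y} \<in> edges G \<longleftrightarrow> {\<phi> x, \<phi> y} \<in> edges G'))"

definition induced :: "'a graph \<Rightarrow> 'a set \<Rightarrow> 'a graph" where
  "induced G W = (W, {e \<in> edges G. e \<subseteq> W})"

definition contains_induced :: "'a graph \<Rightarrow> 'b graph \<Rightarrow> bool" where
  "contains_induced G F \<longleftrightarrow> (\<exists>W\<subseteq>verts G. graph_iso (induced G W) F)"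

text \<open>Classes of graphs are represented by their members with vertices in \<^typ>\<open>nat\<close>;
  every finite graph is isomorphic to one of these.\<close>

definition Free :: "nat graph set \<Rightarrow> nat graph set" where
  "Free \<F> = {G. simple_graph G \<and> (\<forall>F\<in>\<F>. \<not> contains_induced G F)}"

text \<open>The vertices \<open>x\<^sub>i\<close> and \<open>y\<^sub>j\<close> are \<^term>\<open>Inl i\<close> and \<^term>\<open>Inr j\<close>.\<close>

definition pattern_graph :: "(nat \<Rightarrow> nat \<Rightarrow> bool) \<Rightarrow> nat \<Rightarrow> (nat + nat) graph" where
  "pattern_graph R r =
     (Inl ` {1..r} \<union> Inr ` {1..r}, {{Inl i, Inr j} | i j. i \<in> {1..r} \<and> j \<in> {1..r} \<and> R i j})"

definition matching :: "nat \<Rightarrow> (nat + nat) graph" where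
  "matching = pattern_graph (\<lambda>i j. i = j)"

definition comatching :: "nat \<Rightarrow> (nat + nat) graph" where
  "comatching = pattern_graph (\<lambda>i j. i \<noteq> j)"

definition halfgraph :: "nat \<Rightarrow> (nat + nat) graph" where
  "halfgraph = pattern_graph (\<lambda>i j. j \<le> i)"

definition bipartite_with_parts :: "'a graph \<Rightarrow> 'a set \<Rightarrow> 'a set \<Rightarrow> bool" where
  "bipartite_with_parts G A B \<longleftrightarrow> simple_graph G \<and> A \<union> B = verts G \<and> A \<inter> B = {} \<and>
     (\<forall>e\<in>edges G. e \<inter> A \<noteq> {} \<and> e \<inter> B \<noteq> {})"

text \<open>The number \<open>f(p,q,r)\<close> is any number with this property, not necessarily the least one.
  The set \<open>S\<close> consists of \<open>f(p,q,r)\<close> vertices of one part with pairwise distinct neighbourhoods.\<close>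

definition unavoidable_bound :: "(nat \<Rightarrow> nat \<Rightarrow> nat \<Rightarrow> nat) \<Rightarrow> bool" where
  "unavoidable_bound f \<longleftrightarrow> (\<forall>p q r. \<forall>(G :: nat graph) A B S.
     bipartite_with_parts G A B \<and> S \<subseteq> A \<and> card S = f p q r \<and> inj_on (nbhd G) S \<longrightarrow>
     contains_induced G (matching p) \<or> contains_induced G (comatching q) \<or>
     contains_induced G (halfgraph r))"

text \<open>The 4-colour Ramsey number: \<^const>\<open>partn_lst\<close> with exponent 2 speaks about colourings of
  the edges of the complete graph on the given set.\<close>

definition ramsey4 :: "nat \<Rightarrow> nat" where
  "ramsey4 k = (LEAST N. partn_lst {..<N} [k, k, k, k] 2)"

definition bell :: "nat \<Rightarrow> nat" where
  "bell n = card {P. partition_on {1..n} P}"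

definition labelled :: "nat graph set \<Rightarrow> nat \<Rightarrow> nat graph set" where
  "labelled \<C> n = {G \<in> \<C>. verts G = {1..n}}"

definition above_bell :: "nat graph set \<Rightarrow> bool" where
  "above_bell \<C> \<longleftrightarrow> (\<exists>N\<ge>1. \<forall>n\<ge>N. card (labelled \<C> n) \<ge> bell n)"

definition distinguished_by :: "'a graph \<Rightarrow> 'a set \<Rightarrow> nat \<Rightarrow> (nat \<Rightarrow> 'a set) \<Rightarrow> bool" where
  "distinguished_by G X p U \<longleftrightarrow> (\<forall>i\<in>{1..p}. U i \<subseteq> verts G) \<and> disjoint_family_on U {1..p} \<and>
     (\<forall>i\<in>{1..p}. \<forall>x\<in>U i. \<forall>y\<in>U i. nbhd G x \<inter> X = nbhd G y \<inter> X) \<and>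
     (\<forall>i\<in>{1..p}. \<forall>j\<in>{1..p}. i \<noteq> j \<longrightarrow> (\<forall>x\<in>U i. \<forall>y\<in>U j. nbhd G x \<inter> X \<noteq> nbhd G y \<inter> X))"

definition infinite_distinguishing_number :: "nat graph set \<Rightarrow> bool" where
  "infinite_distinguishing_number \<C> \<longleftrightarrow> (\<forall>k l. \<exists>G\<in>\<C>. \<exists>X\<subseteq>verts G. \<exists>p\<ge>l. \<exists>U.
     distinguished_by G X p U \<and> (\<forall>i\<in>{1..p}. card (U i) \<ge> k))"

definition finite_distinguishing_number :: "nat graph set \<Rightarrow> bool" where
  "finite_distinguishing_number \<C> \<longleftrightarrow> \<not> infinite_distinguishing_number \<C>"

text \<open>An infinite word \<open>w\<^sub>1 w\<^sub>2 \<dots>\<close> is a function on \<^typ>\<open>nat\<close> of which only the values at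
  positive arguments matter. The increasing sequence of indices is given by its set \<open>I\<close>.
  If \<open>w i = w j\<close>, then \<open>{w i, w j}\<close> is a loop.\<close>

definition word_graph :: "(nat \<Rightarrow> 'h) \<Rightarrow> 'h graph \<Rightarrow> nat set \<Rightarrow> nat graph" where
  "word_graph w H I = (I, {{i, j} | i j. i \<in> I \<and> j \<in> I \<and> i < j \<and>
     (j - i = 1 \<and> {w i, w j} \<notin> edges H \<or> j - i > 1 \<and> {w i, w j} \<in> edges H)})"

definition word_class :: "(nat \<Rightarrow> 'h) \<Rightarrow> 'h graph \<Rightarrow> nat graph set" where
  "word_class w H =
     {G. simple_graph G \<and> (\<exists>I. finite I \<and> I \<subseteq> {1..} \<and> graph_iso G (word_graph w H I))}"

definition word_over :: "(nat \<Rightarrow> 'h) \<Rightarrow> 'h set \<Rightarrow> bool" where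
  "word_over w A \<longleftrightarrow> (\<forall>i\<ge>1. w i \<in> A)"

definition letters :: "(nat \<Rightarrow> 'h) \<Rightarrow> 'h set" where
  "letters w = w ` {1..}"

definition has_period :: "(nat \<Rightarrow> 'h) \<Rightarrow> nat \<Rightarrow> bool" where
  "has_period w c \<longleftrightarrow> c \<ge> 1 \<and> (\<forall>i\<ge>1. w i = w (i + c))"

end

theory Submission
  imports Defs
begin

text \<open>
  Call the set of pairs at which a graph deviates from an adjacency \<open>D\<close> prescribed by types of vertices
  its sparsification. A finite distinguishing number provides, for all graphs of the class, boundedly
  many types such that the sparsification has bounded degree after the removal of boundedly many
  vertices (\<open>finite_distinguishing_sparse_decomposition\<close>): choose a set \<open>X\<close> with as many large classes
  of equal neighbourhoods in \<open>X\<close> as possible; then every vertex is joined to almost all or almost none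
  of each class.

  If the components of the sparsifications had bounded size, a graph on \<open>n\<close> vertices would be
  determined by a partition into blocks of bounded size and a bounded amount of information per
  vertex, which gives fewer graphs than the Bell number for infinitely many \<open>n\<close>
  (\<open>small_components_not_above_bell\<close>). As degrees are bounded, there are instead arbitrarily long
  induced paths in sparsifications. The types along such a path form a word, and the path induces
  in the graph the structure that a word induces in \<open>\<P>(w,H)\<close>. By the pigeonhole principle a single
  word \<open>u\<close> of any prescribed length can be found in arbitrarily many copies that are far apart
  (\<open>above_bell_has_copies\<close>).

  Since the forbidden graphs have at most \<open>m\<close> vertices, a graph belongs to the class as soon as all its
  sets of at most \<open>m\<close> vertices can be found in the class (\<open>Free_localI\<close>). This is used twice. Letters
  with the same neighbours can be identified, and if more than \<open>l\<close> letters remained, then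
  a large matching, comatching or halfgraph between letters would appear; by Ramsey's theorem it
  becomes homogeneous with \<open>m\<close> indices, and by locality the blow-ups of such patterns of every size
  belong to the class, which makes the distinguishing number infinite (\<open>card_letters_le\<close>). And a word
  \<open>u\<close> of length \<open>l ^ m + m\<close> over \<open>l\<close> letters contains some factor of length \<open>m\<close> twice; repeating the part
  between the two occurrences gives a periodic word all of whose factors of length \<open>m\<close> occur in \<open>u\<close>,
  and by locality its word class is contained in the given class (\<open>periodic_word_class_subset\<close>).
\<close>

section \<open>Embeddings\<close>

abbreviation adj :: "'a graph \<Rightarrow> 'a \<Rightarrow> 'a \<Rightarrow> bool" where
  "adj G x y \<equiv> {x, y} \<in> edges G"

text \<open>Only distinct pairs are compared, so that the target relation may carry loops: this is what
  allows letters with and without loops to be treated alike.\<close>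

definition embeds :: "'a set \<Rightarrow> ('a \<Rightarrow> 'a \<Rightarrow> bool) \<Rightarrow> 'b set \<Rightarrow> ('b \<Rightarrow> 'b \<Rightarrow> bool) \<Rightarrow> bool" where
  "embeds V R W S \<longleftrightarrow> (\<exists>\<phi>. inj_on \<phi> V \<and> \<phi> ` V \<subseteq> W \<and>
     (\<forall>x\<in>V. \<forall>y\<in>V. x \<noteq> y \<longrightarrow> R x y = S (\<phi> x) (\<phi> y)))"

lemma embedsI:
  assumes "inj_on \<phi> V" "\<And>x. x \<in> V \<Longrightarrow> \<phi> x \<in> W"
    "\<And>x y. x \<in> V \<Longrightarrow> y \<in> V \<Longrightarrow> x \<noteq> y \<Longrightarrow> R x y = S (\<phi> x) (\<phi> y)"
  shows "embeds V R W S"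
  unfolding embeds_def using assms by (intro exI[of _ \<phi>]) auto

lemma embedsE:
  assumes "embeds V R W S"
  obtains \<phi> where "inj_on \<phi> V" "\<And>x. x \<in> V \<Longrightarrow> \<phi> x \<in> W"
    "\<And>x y. x \<in> V \<Longrightarrow> y \<in> V \<Longrightarrow> x \<noteq> y \<Longrightarrow> R x y = S (\<phi> x) (\<phi> y)"
  using assms unfolding embeds_def image_subset_iff by (elim exE conjE) (rule that, auto)

lemma embeds_trans:
  assumes "embeds V R W S" "embeds W S Z T"
  shows "embeds V R Z T"
proof -
  obtain \<phi> where f: "inj_on \<phi> V" "\<And>x. x \<in> V \<Longrightarrow> \<phi> x \<in> W"
    "\<And>x y. x \<in> V \<Longrightarrow> y \<in> V \<Longrightarrow> x \<noteq> y \<Longrightarrow> R x y = S (\<phi> x) (\<phi> y)"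
    using assms(1) by (elim embedsE) (rule that, auto)
  obtain \<psi> where g: "inj_on \<psi> W" "\<And>x. x \<in> W \<Longrightarrow> \<psi> x \<in> Z"
    "\<And>x y. x \<in> W \<Longrightarrow> y \<in> W \<Longrightarrow> x \<noteq> y \<Longrightarrow> S x y = T (\<psi> x) (\<psi> y)"
    using assms(2) by (elim embedsE) (rule that, auto)
  have fi: "\<phi> x \<noteq> \<phi> y" if "x \<in> V" "y \<in> V" "x \<noteq> y" for x y
    using f(1) that by (auto dest: inj_onD)
  show ?thesis
  proof (rule embedsI[of "\<psi> \<circ> \<phi>"])
    show "inj_on (\<psi> \<circ> \<phi>) V"
      using f(1,2) g(1) by (meson comp_inj_on image_subsetI inj_on_subset)
  qed (use f g fi in auto)
qed

lemma simple_graph_no_loop: "simple_graph G \<Longrightarrow> \<not> adj G x x"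
  by (auto simp: simple_graph_def)

lemma contains_induced_iff_embeds:
  assumes "simple_graph G" "simple_graph F"
  shows "contains_induced G F \<longleftrightarrow> embeds (verts F) (adj F) (verts G) (adj G)"
proof
  assume "contains_induced G F"
  then obtain W \<phi> where W: "W \<subseteq> verts G" and bij: "bij_betw \<phi> W (verts F)"
    and E: "\<And>x y. x \<in> W \<Longrightarrow> y \<in> W \<Longrightarrow> adj G x y \<longleftrightarrow> adj F (\<phi> x) (\<phi> y)"
    unfolding contains_induced_def graph_iso_def induced_def by auto
  let ?g = "inv_into W \<phi>"
  have g: "?g x \<in> W" "\<phi> (?g x) = x" if "x \<in> verts F" for x
    using bij that by (auto simp: bij_betw_def inv_into_into f_inv_into_f)
  show "embeds (verts F) (adj F) (verts G) (adj G)"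
  proof (rule embedsI[of ?g])
    show "inj_on ?g (verts F)"
      using bij bij_betw_inv_into bij_betw_def by blast
  qed (use g W E in auto)
next
  assume "embeds (verts F) (adj F) (verts G) (adj G)"
  then obtain \<phi> where f: "inj_on \<phi> (verts F)" "\<And>x. x \<in> verts F \<Longrightarrow> \<phi> x \<in> verts G"
    "\<And>x y. x \<in> verts F \<Longrightarrow> y \<in> verts F \<Longrightarrow> x \<noteq> y \<Longrightarrow> adj F x y = adj G (\<phi> x) (\<phi> y)"
    by (elim embedsE) (rule that, auto)
  let ?W = "\<phi> ` verts F" and ?g = "inv_into (verts F) \<phi>"
  have "bij_betw ?g ?W (verts F)"
    using f(1) by (simp add: inj_on_imp_bij_betw bij_betw_inv_into)
  moreover have "adj G (\<phi> x) (\<phi> y) \<longleftrightarrow> adj F x y" if "x \<in> verts F" "y \<in> verts F" for x y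
    using f(3)[OF that] simple_graph_no_loop[OF assms(1)] simple_graph_no_loop[OF assms(2)]
    by (cases "x = y") auto
  ultimately have "graph_iso (induced G ?W) F"
    unfolding graph_iso_def induced_def using f(1)
    by (intro exI[of _ ?g]) auto
  thus "contains_induced G F"
    unfolding contains_induced_def using f(2) by (intro exI[of _ ?W]) auto
qed

text \<open>Membership in a class given by forbidden induced subgraphs with at most \<open>m\<close> vertices can be
  tested on the vertex sets of size at most \<open>m\<close>; it suffices that each of them looks like
  something inside some member of the class.\<close>

lemma Free_localI:
  assumes "\<forall>F\<in>\<F>. simple_graph F \<and> card (verts F) \<le> m"
    and "simple_graph G"
    and loc: "\<And>W. W \<subseteq> verts G \<Longrightarrow> card W \<le> m \<Longrightarrow>
      \<exists>G'\<in>Free \<F>. embeds W (adj G) (verts G') (adj G')"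
  shows "G \<in> Free \<F>"
  unfolding Free_def
proof (intro CollectI conjI ballI notI)
  fix F assume F: "F \<in> \<F>" and c: "contains_induced G F"
  have sF: "simple_graph F" "card (verts F) \<le> m" using assms(1) F by auto
  have "embeds (verts F) (adj F) (verts G) (adj G)"
    using c contains_induced_iff_embeds[OF assms(2) sF(1)] by simp
  then obtain \<phi> where f: "inj_on \<phi> (verts F)" "\<And>x. x \<in> verts F \<Longrightarrow> \<phi> x \<in> verts G"
    "\<And>x y. x \<in> verts F \<Longrightarrow> y \<in> verts F \<Longrightarrow> x \<noteq> y \<Longrightarrow> adj F x y = adj G (\<phi> x) (\<phi> y)"
    by (elim embedsE) (rule that, auto)
  have "embeds (verts F) (adj F) (\<phi> ` verts F) (adj G)"
    by (rule embedsI[of \<phi>]) (use f in auto)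
  moreover have "card (\<phi> ` verts F) \<le> m"
    using sF f(1) by (simp add: card_image)
  ultimately obtain G' where "G' \<in> Free \<F>" "embeds (verts F) (adj F) (verts G') (adj G')"
    using loc[of "\<phi> ` verts F"] f(2) embeds_trans by blast
  thus False
    using F contains_induced_iff_embeds[OF _ sF(1), of G'] by (auto simp: Free_def)
qed (use assms in auto)

section \<open>Words repeated far apart\<close>

text \<open>The graph made of copies of the word \<open>u\<close> which are far apart in an infinite word: the vertex
  \<open>(r, i)\<close> is the \<open>i\<close>-th position of copy \<open>r\<close>.\<close>

definition copies_adj :: "('h \<Rightarrow> 'h \<Rightarrow> bool) \<Rightarrow> (nat \<Rightarrow> 'h) \<Rightarrow> nat \<times> nat \<Rightarrow> nat \<times> nat \<Rightarrow> bool" where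
  "copies_adj D u x y \<longleftrightarrow>
     (fst x = fst y \<and> (snd y = Suc (snd x) \<or> snd x = Suc (snd y))) \<noteq> D (u (snd x)) (u (snd y))"

definition has_copies :: "nat graph set \<Rightarrow> ('h \<Rightarrow> 'h \<Rightarrow> bool) \<Rightarrow> (nat \<Rightarrow> 'h) \<Rightarrow> nat \<Rightarrow> bool" where
  "has_copies \<C> D u N \<longleftrightarrow>
     (\<forall>q. \<exists>G\<in>\<C>. embeds ({..<q} \<times> {..<N}) (copies_adj D u) (verts G) (adj G))"

lemma has_copiesD:
  assumes "has_copies \<C> D u N" "finite V"
    and "embeds V R (UNIV \<times> {..<N}) (copies_adj D u)"
  shows "\<exists>G\<in>\<C>. embeds V R (verts G) (adj G)"
proof -
  obtain \<phi> where f: "inj_on \<phi> V" "\<And>x. x \<in> V \<Longrightarrow> \<phi> x \<in> UNIV \<times> {..<N}"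
    "\<And>x y. x \<in> V \<Longrightarrow> y \<in> V \<Longrightarrow> x \<noteq> y \<Longrightarrow> R x y = copies_adj D u (\<phi> x) (\<phi> y)"
    using assms(3) by (elim embedsE) (rule that, auto)
  obtain q where q: "\<And>r. r \<in> fst ` \<phi> ` V \<Longrightarrow> r < q"
    using assms(2) finite_nat_set_iff_bounded[of "fst ` \<phi> ` V"] by auto
  have "embeds V R ({..<q} \<times> {..<N}) (copies_adj D u)"
  proof (rule embedsI[of \<phi>])
    show "\<phi> x \<in> {..<q} \<times> {..<N}" if "x \<in> V" for x
      using f(2)[OF that] q[of "fst (\<phi> x)"] that by (auto simp: mem_Times_iff)
  qed (use f(1,3) in auto)
  thus ?thesis using assms(1) embeds_trans unfolding has_copies_def by blast
qed

text \<open>Vertices placed in different copies only see the letters.\<close>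

lemma has_copies_blow_up:
  assumes "has_copies \<C> D u N" "finite (V :: nat set)" "\<And>v. v \<in> V \<Longrightarrow> c v \<in> u ` {..<N}"
  shows "\<exists>G\<in>\<C>. embeds V (\<lambda>x y. D (c x) (c y)) (verts G) (adj G)"
proof (rule has_copiesD[OF assms(1,2)])
  have "\<forall>v\<in>V. \<exists>i. i < N \<and> u i = c v"
    using assms(3) by (metis imageE lessThan_iff)
  then obtain p where p: "\<forall>v\<in>V. p v < N \<and> u (p v) = c v"
    by metis
  show "embeds V (\<lambda>x y. D (c x) (c y)) (UNIV \<times> {..<N}) (copies_adj D u)"
    by (rule embedsI[of "\<lambda>v. (v, p v)"]) (use p in \<open>auto simp: inj_on_def copies_adj_def\<close>)
qed

section \<open>From repeated words to periodic words\<close>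

lemma adj_word_graph:
  assumes "x \<in> I" "y \<in> I" "x \<noteq> y"
  shows "adj (word_graph w H I) x y \<longleftrightarrow> (y = Suc x \<or> x = Suc y) \<noteq> ({w x, w y} \<in> edges H)"
proof -
  have *: "adj (word_graph w H I) x y \<longleftrightarrow> (y = Suc x) \<noteq> ({w x, w y} \<in> edges H)"
    if "x \<in> I" "y \<in> I" "x < y" for x y
  proof -
    have "(y - x = 1) = (y = Suc x)" "(y - x > 1) = (y \<noteq> Suc x)" using that by auto
    moreover have "adj (word_graph w H I) x y \<longleftrightarrow>
       (y - x = 1 \<and> {w x, w y} \<notin> edges H \<or> y - x > 1 \<and> {w x, w y} \<in> edges H)"
      using that by (auto simp: word_graph_def doubleton_eq_iff)
    ultimately show ?thesis by auto
  qed
  show ?thesis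
    using *[of x y] *[of y x] assms by (cases "x < y") (auto simp: insert_commute)
qed

text \<open>If the same factor of length \<open>m\<close> occurs in \<open>u\<close> at positions \<open>i < j\<close>, then each factor of length
  at most \<open>m\<close> of the periodic word that repeats the letters of \<open>u\<close> between \<open>i\<close> and \<open>j\<close> is already a
  factor of \<open>u\<close>. A set of at most \<open>m\<close> positions falls into runs of consecutive positions, and the
  runs can be put into different copies of \<open>u\<close>.\<close>

lemma periodic_word_class_subset:
  fixes u :: "nat \<Rightarrow> 'h"
  assumes small: "\<forall>F\<in>\<F>. simple_graph F \<and> card (verts F) \<le> m"
    and copies: "has_copies (Free \<F>) D u N"
    and sym: "\<And>a b. D a b \<longleftrightarrow> D b a"
    and "i < j" "j + m \<le> N" and eq: "\<And>s. s < m \<Longrightarrow> u (i + s) = u (j + s)"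
  defines "A \<equiv> u ` {..<N}"
  defines "H \<equiv> (A, {{a, b} | a b. a \<in> A \<and> b \<in> A \<and> D a b})"
  defines "w \<equiv> (\<lambda>t. u (i + t mod (j - i)))"
  shows "word_class w H \<subseteq> Free \<F>"
proof
  define p where "p = j - i"
  have p: "p > 0" "i + p = j" using \<open>i < j\<close> by (auto simp: p_def)
  have factor: "u (i + s) = u (i + s mod p)" if "s < p + m" for s
    using that
  proof (induction s rule: less_induct)
    case (less s)
    show ?case
    proof (cases "s < p")
      case False
      have "i + s = j + (s - p)" using False p(2) by linarith
      hence "u (i + s) = u (j + (s - p))" by simp
      also have "\<dots> = u (i + (s - p))" using eq[of "s - p"] False less.prems p by simp
      also have "\<dots> = u (i + (s - p) mod p)" using less False p by (intro less.IH) auto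
      finally show ?thesis using False by (simp add: le_mod_geq)
    qed simp
  qed
  have wA: "w t \<in> A" for t
  proof -
    have "t mod p < p" using p by simp
    hence "i + t mod p < N" using p \<open>j + m \<le> N\<close> by linarith
    thus ?thesis unfolding w_def A_def p_def[symmetric] by blast
  qed
  have wH: "{w x, w y} \<in> edges H \<longleftrightarrow> D (w x) (w y)" for x y
    using wA sym by (auto simp: H_def doubleton_eq_iff)
  fix G assume "G \<in> word_class w H"
  then obtain I \<psi> where G: "simple_graph G" "bij_betw \<psi> (verts G) I"
    and iso: "\<And>x y. x \<in> verts G \<Longrightarrow> y \<in> verts G \<Longrightarrow> adj G x y \<longleftrightarrow> adj (word_graph w H I) (\<psi> x) (\<psi> y)"
    unfolding word_class_def graph_iso_def by (auto simp: word_graph_def)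
  show "G \<in> Free \<F>"
  proof (rule Free_localI[OF small G(1)])
    fix W assume W: "W \<subseteq> verts G" "card W \<le> m"
    have fW: "finite W" using W G(1) finite_subset by (auto simp: simple_graph_def)
    define J where "J = \<psi> ` W"
    have inj: "inj_on \<psi> W" using G(2) W(1) by (auto simp: bij_betw_def intro: inj_on_subset)
    have J: "finite J" "card J \<le> m" "J \<subseteq> I"
      using fW W inj G(2) by (auto simp: J_def card_image bij_betw_def)
    \<comment> \<open>The run of \<open>x\<close> in \<open>J\<close> is identified by its first element, which serves as the number of its copy.\<close>
    define s where "s x = (LEAST y. {y..x} \<subseteq> J)" for x
    have s: "s x \<le> x" "{s x..x} \<subseteq> J" if "x \<in> J" for x
    proof -
      have "{x..x} \<subseteq> J" using that by simp
      thus "{s x..x} \<subseteq> J" "s x \<le> x" unfolding s_def by (rule LeastI, rule Least_le)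
    qed
    have len: "x - s x < m" if "x \<in> J" for x
      using card_mono[OF J(1) s(2)[OF that]] J(2) s(1)[OF that] by simp
    have s_Suc: "s (Suc x) = s x" if "x \<in> J" "Suc x \<in> J" for x
    proof (rule antisym)
      have "{s x..Suc x} \<subseteq> J" using s[OF that(1)] that(2) by (auto simp: atLeastAtMostSuc_conv)
      thus 1: "s (Suc x) \<le> s x" unfolding s_def[of "Suc x"] by (rule Least_le)
      have "{s (Suc x)..x} \<subseteq> J" using s(2)[OF that(2)] by auto
      thus "s x \<le> s (Suc x)" unfolding s_def[of x] by (rule Least_le)
    qed
    define \<phi> where "\<phi> x = (s x, i + (s x mod p + (x - s x)))" for x
    have smod: "s x mod p < p" for x using p by simp
    have \<phi>N: "\<phi> x \<in> UNIV \<times> {..<N}" if "x \<in> J" for x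
    proof -
      have "i + (s x mod p + (x - s x)) < N"
        using len[OF that] smod[of x] p \<open>j + m \<le> N\<close> by linarith
      thus ?thesis by (simp add: \<phi>_def)
    qed
    have \<phi>u: "u (snd (\<phi> x)) = w x" if "x \<in> J" for x
    proof -
      have "u (snd (\<phi> x)) = u (i + (s x mod p + (x - s x)) mod p)"
        using factor[of "s x mod p + (x - s x)"] len[OF that] smod[of x] by (simp add: \<phi>_def)
      also have "(s x mod p + (x - s x)) mod p = x mod p"
        by (subst mod_add_left_eq) (simp add: s(1)[OF that])
      finally show ?thesis by (simp add: w_def p_def)
    qed
    have \<phi>inj: "x = y" if "x \<in> J" "y \<in> J" "\<phi> x = \<phi> y" for x y
      using that s(1)[OF that(1)] s(1)[OF that(2)] by (auto simp: \<phi>_def)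
    have \<phi>Suc: "fst (\<phi> x) = fst (\<phi> y) \<and> snd (\<phi> y) = Suc (snd (\<phi> x)) \<longleftrightarrow> y = Suc x"
      if "x \<in> J" "y \<in> J" for x y
      using s(1)[OF that(1)] s(1)[OF that(2)] s_Suc[of x] that
      by (auto simp: \<phi>_def Suc_diff_le)
    have "embeds W (adj G) (UNIV \<times> {..<N}) (copies_adj D u)"
    proof (rule embedsI[of "\<phi> \<circ> \<psi>"])
      show "inj_on (\<phi> \<circ> \<psi>) W"
        using inj \<phi>inj by (intro comp_inj_on) (auto simp: inj_on_def J_def)
      fix x assume x: "x \<in> W"
      thus "(\<phi> \<circ> \<psi>) x \<in> UNIV \<times> {..<N}" using \<phi>N[of "\<psi> x"] by (auto simp: J_def)
      fix y assume y: "y \<in> W" "x \<noteq> y"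
      have xy: "\<psi> x \<in> J" "\<psi> y \<in> J" "\<psi> x \<noteq> \<psi> y"
        using x y inj by (auto simp: J_def dest: inj_onD)
      have "adj G x y \<longleftrightarrow> (\<psi> y = Suc (\<psi> x) \<or> \<psi> x = Suc (\<psi> y)) \<noteq> D (w (\<psi> x)) (w (\<psi> y))"
        using iso[of x y] adj_word_graph[of "\<psi> x" I "\<psi> y" w H] xy J(3) x y(1) W(1) wH by auto
      thus "adj G x y \<longleftrightarrow> copies_adj D u ((\<phi> \<circ> \<psi>) x) ((\<phi> \<circ> \<psi>) y)"
        using \<phi>u[OF xy(1)] \<phi>u[OF xy(2)] \<phi>Suc[OF xy(1,2)] \<phi>Suc[OF xy(2,1)]
        by (auto simp: copies_adj_def)
    qed
    thus "\<exists>G'\<in>Free \<F>. embeds W (adj G) (verts G') (adj G')"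
      by (rule has_copiesD[OF copies fW])
  qed
qed

section \<open>Removing superfluous letters\<close>

text \<open>Letters with the same neighbours among the letters can be identified, as replacing a letter by its
  twin changes no adjacency.\<close>

lemma has_copies_merge_twins:
  fixes u :: "nat \<Rightarrow> 'h"
  assumes copies: "has_copies \<C> D u N" and sym: "\<And>a b. D a b \<longleftrightarrow> D b a"
  obtains u' where "has_copies \<C> D u' N"
    "inj_on (\<lambda>a. {b \<in> u' ` {..<N}. D a b}) (u' ` {..<N})"
proof -
  define A where "A = u ` {..<N}"
  define nb where "nb a = {b \<in> A. D a b}" for a
  define rep where "rep a = (SOME b. b \<in> A \<and> nb b = nb a)" for a
  have rep: "rep a \<in> A" "nb (rep a) = nb a" if "a \<in> A" for a
    using someI[of "\<lambda>b. b \<in> A \<and> nb b = nb a" a] that by (auto simp: rep_def)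
  have rep_cong: "rep a = rep b" if "nb a = nb b" for a b
    using that by (simp add: rep_def)
  have D1: "D (rep a) b \<longleftrightarrow> D a b" if "a \<in> A" "b \<in> A" for a b
    using rep[OF that(1)] that(2) by (auto simp: nb_def)
  have D2: "D a (rep b) \<longleftrightarrow> D a b" if "a \<in> A" "b \<in> A" for a b
    using D1[OF that(2,1)] sym by blast
  have D: "D (rep a) (rep b) \<longleftrightarrow> D a b" if "a \<in> A" "b \<in> A" for a b
    using D1[of a "rep b"] D2[of a b] that rep by blast
  let ?u' = "\<lambda>i. rep (u i)"
  have "embeds ({..<q} \<times> {..<N}) (copies_adj D ?u') ({..<q} \<times> {..<N}) (copies_adj D u)" for q
    by (rule embedsI[of "\<lambda>x. x"]) (auto simp: copies_adj_def D A_def)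
  from embeds_trans[OF this] have "has_copies \<C> D ?u' N"
    using copies unfolding has_copies_def by blast
  moreover have "inj_on (\<lambda>a. {b \<in> ?u' ` {..<N}. D a b}) (?u' ` {..<N})"
  proof (rule inj_onI)
    have im: "?u' ` {..<N} = rep ` A" by (auto simp: A_def)
    fix a b assume "a \<in> ?u' ` {..<N}" "b \<in> ?u' ` {..<N}"
      and eq: "{c \<in> ?u' ` {..<N}. D a c} = {c \<in> ?u' ` {..<N}. D b c}"
    then obtain a' b' where ab: "a' \<in> A" "a = rep a'" "b' \<in> A" "b = rep b'" by (auto simp: A_def)
    have "a \<in> A" "b \<in> A" using ab rep by auto
    have "D a c \<longleftrightarrow> D b c" if "c \<in> A" for c
    proof -
      have "rep c \<in> ?u' ` {..<N}" using that im by auto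
      hence "D a (rep c) \<longleftrightarrow> D b (rep c)" using eq by (simp add: set_eq_iff) metis
      thus ?thesis using D2[OF \<open>a \<in> A\<close> that] D2[OF \<open>b \<in> A\<close> that] by simp
    qed
    hence "nb a = nb b" by (auto simp: nb_def)
    hence "nb a' = nb b'" using ab rep by auto
    thus "a = b" using ab rep_cong by blast
  qed
  ultimately show ?thesis using that by blast
qed

section \<open>Few letters suffice\<close>

text \<open>In matchings, comatchings and halfgraphs, adjacency only depends on how the two indices compare.
  This property is invariant under increasing changes of the indices.\<close>

definition compare :: "bool \<Rightarrow> bool \<Rightarrow> bool \<Rightarrow> nat \<Rightarrow> nat \<Rightarrow> bool" where
  "compare lt eq gt i j \<longleftrightarrow> (if i < j then lt else if i = j then eq else gt)"

lemma simple_pattern_graph: "simple_graph (pattern_graph R r)"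
  by (auto simp: simple_graph_def pattern_graph_def)

lemma adj_pattern_graph:
  "adj (pattern_graph R r) (Inl i) (Inr j) \<longleftrightarrow> i \<in> {1..r} \<and> j \<in> {1..r} \<and> R i j"
  "\<not> adj (pattern_graph R r) (Inl i) (Inl j)"
  "\<not> adj (pattern_graph R r) (Inr i) (Inr j)"
  by (auto simp: pattern_graph_def doubleton_eq_iff)

text \<open>The bipartite double cover of \<open>D\<close> on \<open>A\<close>: a letter \<open>a\<close> becomes \<open>2 * a\<close> on one side and \<open>2 * a + 1\<close> on
  the other.\<close>

definition double_cover :: "(nat \<Rightarrow> nat \<Rightarrow> bool) \<Rightarrow> nat set \<Rightarrow> nat graph" where
  "double_cover D A = ((\<lambda>a. 2 * a) ` A \<union> (\<lambda>a. 2 * a + 1) ` A,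
     {{2 * a, 2 * b + 1} | a b. a \<in> A \<and> b \<in> A \<and> D a b})"

lemma verts_double_cover: "x \<in> verts (double_cover D A) \<longleftrightarrow> x div 2 \<in> A"
proof
  assume "x div 2 \<in> A"
  moreover have "x = 2 * (x div 2) \<or> x = 2 * (x div 2) + 1" by presburger
  ultimately show "x \<in> verts (double_cover D A)" by (auto simp: double_cover_def)
qed (auto simp: double_cover_def)

lemma adj_double_cover:
  assumes sym: "\<And>a b. D a b \<longleftrightarrow> D b a"
  shows "adj (double_cover D A) x y \<longleftrightarrow>
    even x \<noteq> even y \<and> x div 2 \<in> A \<and> y div 2 \<in> A \<and> D (x div 2) (y div 2)"
    (is "?L = ?R")
proof
  assume ?L
  then obtain a b where "{x, y} = {2 * a, 2 * b + 1}" "a \<in> A" "b \<in> A" "D a b"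
    unfolding double_cover_def by auto
  thus ?R using sym by (auto simp: doubleton_eq_iff)
next
  assume ?R
  show ?L
  proof (cases "even x")
    case True
    hence "{x, y} = {2 * (x div 2), 2 * (y div 2) + 1}" using \<open>?R\<close> by simp
    thus ?thesis using \<open>?R\<close> unfolding double_cover_def snd_conv by blast
  next
    case False
    hence "{x, y} = {2 * (y div 2), 2 * (x div 2) + 1}" using \<open>?R\<close> by auto
    thus ?thesis using \<open>?R\<close> sym unfolding double_cover_def snd_conv by blast
  qed
qed

lemma simple_double_cover:
  assumes "finite A"
  shows "simple_graph (double_cover D A)"
proof -
  have "2 * a \<noteq> Suc (2 * b)" for a b :: nat by presburger
  thus ?thesis using assms by (auto simp: simple_graph_def double_cover_def)
qed

text \<open>A pattern found in the double cover may use a letter on both sides. Which side a vertex lies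
  on matters little, as \<open>D\<close> is symmetric: in a connected pattern the sides are separated, and in a
  matching each edge can be turned around.\<close>

lemma letters_with_pattern:
  fixes D :: "nat \<Rightarrow> nat \<Rightarrow> bool"
  assumes f: "unavoidable_bound f" and "finite A" and "f M M M \<le> card A" and "3 \<le> M"
    and sym: "\<And>a b. D a b \<longleftrightarrow> D b a"
    and twins: "inj_on (\<lambda>a. {b \<in> A. D a b}) A"
  obtains xs ys lt eq gt where "\<not> (lt = eq \<and> eq = gt)"
    "\<And>i. i \<in> {1..M} \<Longrightarrow> xs i \<in> A \<and> ys i \<in> A"
    "\<And>i j. i \<in> {1..M} \<Longrightarrow> j \<in> {1..M} \<Longrightarrow> D (xs i) (ys j) \<longleftrightarrow> compare lt eq gt i j"
proof -
  let ?G = "double_cover D A"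
  let ?L = "(\<lambda>a. 2 * a) ` A" and ?R = "(\<lambda>a. 2 * a + 1) ` A"
  obtain S0 where S0: "S0 \<subseteq> A" "card S0 = f M M M"
    using obtain_subset_with_card_n[OF \<open>f M M M \<le> card A\<close>] by blast
  have "?L \<inter> ?R = {}" by (auto, presburger)
  hence bip: "bipartite_with_parts ?G ?L ?R"
    using simple_double_cover[OF \<open>finite A\<close>]
    by (auto simp: bipartite_with_parts_def double_cover_def)
  have "inj_on (nbhd ?G) ((\<lambda>a. 2 * a) ` S0)"
  proof (rule inj_onI)
    fix x y assume "x \<in> (\<lambda>a. 2 * a) ` S0" "y \<in> (\<lambda>a. 2 * a) ` S0" and eq: "nbhd ?G x = nbhd ?G y"
    then obtain a b where ab: "a \<in> A" "b \<in> A" "x = 2 * a" "y = 2 * b" using S0 by auto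
    have nb: "2 * c + 1 \<in> nbhd ?G (2 * a) \<longleftrightarrow> c \<in> A \<and> D a c" if "a \<in> A" for a c
      using that verts_double_cover[of "2 * c + 1"] adj_double_cover[of D, OF sym]
      by (auto simp: nbhd_def)
    have "{c \<in> A. D a c} = {c \<in> A. D b c}"
      using nb[OF ab(1)] nb[OF ab(2)] eq ab(3,4) by auto
    thus "x = y" using inj_onD[OF twins _ ab(1,2)] ab(3,4) by simp
  qed
  moreover have "card ((\<lambda>a. 2 * a) ` S0) = f M M M"
    using S0 by (simp add: card_image inj_on_def)
  ultimately have "contains_induced ?G (matching M) \<or> contains_induced ?G (comatching M) \<or>
     contains_induced ?G (halfgraph M)"
    using f bip S0(1) unfolding unavoidable_bound_def
    by (meson image_mono)
  then obtain R where R: "contains_induced ?G (pattern_graph R M)"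
    "R = (=) \<or> R = (\<noteq>) \<or> R = (\<lambda>i j. j \<le> i)"
    unfolding matching_def comatching_def halfgraph_def by blast
  have "embeds (verts (pattern_graph R M)) (adj (pattern_graph R M)) (verts ?G) (adj ?G)"
    using R(1) contains_induced_iff_embeds[OF simple_double_cover[OF \<open>finite A\<close>] simple_pattern_graph]
    by simp
  then obtain \<psi> where \<psi>: "inj_on \<psi> (verts (pattern_graph R M))"
    "\<And>x. x \<in> verts (pattern_graph R M) \<Longrightarrow> \<psi> x \<in> verts ?G"
    "\<And>x y. x \<in> verts (pattern_graph R M) \<Longrightarrow> y \<in> verts (pattern_graph R M) \<Longrightarrow> x \<noteq> y \<Longrightarrow>
      adj (pattern_graph R M) x y = adj ?G (\<psi> x) (\<psi> y)"
    by (elim embedsE) (rule that, auto)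
  define a b where "a i = \<psi> (Inl i) div 2" and "b i = \<psi> (Inr i) div 2" for i
  define P Q where "P i = even (\<psi> (Inl i))" and "Q i = even (\<psi> (Inr i))" for i
  have V: "Inl i \<in> verts (pattern_graph R M)" "Inr i \<in> verts (pattern_graph R M)"
    if "i \<in> {1..M}" for i
    using that by (auto simp: pattern_graph_def)
  have A: "a i \<in> A" "b i \<in> A" if "i \<in> {1..M}" for i
    using \<psi>(2) V[OF that] verts_double_cover unfolding a_def b_def by blast+
  have ab: "R i j \<longleftrightarrow> P i \<noteq> Q j \<and> D (a i) (b j)" if "i \<in> {1..M}" "j \<in> {1..M}" for i j
    using \<psi>(3)[OF V(1)[OF that(1)] V(2)[OF that(2)]] adj_pattern_graph(1)[where R = R and r = M and i = i and j = j] A that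
    unfolding a_def b_def P_def Q_def adj_double_cover[of D, OF sym] by auto
  have aa: "\<not> D (a i) (a j)" if "i \<in> {1..M}" "j \<in> {1..M}" "P i \<noteq> P j" for i j
    using \<psi>(3)[OF V(1)[OF that(1)] V(1)[OF that(2)]] adj_pattern_graph(2)[where R = R and r = M and i = i and j = j] A that
    unfolding a_def b_def P_def Q_def adj_double_cover[of D, OF sym] by auto
  have bb: "\<not> D (b i) (b j)" if "i \<in> {1..M}" "j \<in> {1..M}" "Q i \<noteq> Q j" for i j
    using \<psi>(3)[OF V(2)[OF that(1)] V(2)[OF that(2)]] adj_pattern_graph(3)[where R = R and r = M and i = i and j = j] A that
    unfolding a_def b_def P_def Q_def adj_double_cover[of D, OF sym] by auto
  from R(2) consider "R = (=)" | "R = (\<noteq>)" | "R = (\<lambda>i j. j \<le> i)" by blast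
  thus ?thesis
  proof cases
    case 1
    have PQ: "Q i = (\<not> P i)" if "i \<in> {1..M}" for i using ab[OF that that] 1 by auto
    define xs ys where "xs i = (if P i then a i else b i)" and "ys i = (if P i then b i else a i)" for i
    show ?thesis
    proof (rule that[of False True False xs ys])
      fix i j assume ij: "i \<in> {1..M}" "j \<in> {1..M}"
      show "D (xs i) (ys j) \<longleftrightarrow> compare False True False i j"
        using ab[OF ij] ab[OF ij(2,1)] aa[OF ij] bb[OF ij] PQ[OF ij(1)] PQ[OF ij(2)] 1 sym
        by (auto simp: xs_def ys_def compare_def)
    qed (use A in \<open>auto simp: xs_def ys_def\<close>)
  next
    case 2
    have M: "1 \<in> {1..M}" "2 \<in> {1..M}" "3 \<in> {1..M}" using \<open>3 \<le> M\<close> by auto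
    have ne: "P i \<noteq> Q j" if "i \<in> {1..M}" "j \<in> {1..M}" "i \<noteq> j" for i j
      using ab[OF that(1,2)] that 2 by auto
    have "P i \<noteq> Q j" if "i \<in> {1..M}" "j \<in> {1..M}" for i j
    proof (cases "i = j")
      case True
      \<comment> \<open>Two further indices connect \<open>x\<^sub>i\<close> with \<open>y\<^sub>i\<close> by a path of length three.\<close>
      obtain k l where "k \<in> {1..M}" "l \<in> {1..M}" "k \<noteq> i" "l \<noteq> i" "k \<noteq> l"
        using M that[of 2 3] that[of 1 3] that[of 1 2] by (cases "i = 1"; cases "i = 2") auto
      thus ?thesis using ne[of i k] ne[of l k] ne[of l i] that True by auto
    qed (use ne that in auto)
    hence "D (a i) (b j) \<longleftrightarrow> compare True False True i j" if "i \<in> {1..M}" "j \<in> {1..M}" for i j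
      using ab[OF that] that 2 by (auto simp: compare_def)
    thus ?thesis using that[of True False True a b] A by auto
  next
    case 3
    have M: "1 \<in> {1..M}" "M \<in> {1..M}" using \<open>3 \<le> M\<close> by auto
    have "P i \<noteq> Q j" if "i \<in> {1..M}" "j \<in> {1..M}" for i j
      using ab[of i 1] ab[of M 1] ab[of M j] 3 M that by auto
    hence "D (a i) (b j) \<longleftrightarrow> compare False True True i j" if "i \<in> {1..M}" "j \<in> {1..M}" for i j
      using ab[OF that] that 3 by (auto simp: compare_def)
    thus ?thesis using that[of False True True a b] A by auto
  qed
qed

lemma ramsey4_two_relations:
  fixes P Q :: "nat \<Rightarrow> nat \<Rightarrow> bool"
  assumes sym: "\<And>i j. P i j \<longleftrightarrow> P j i" "\<And>i j. Q i j \<longleftrightarrow> Q j i"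
  obtains J \<alpha> \<beta> where "J \<subseteq> {1..ramsey4 k}" "card J = k"
    "\<And>i j. i \<in> J \<Longrightarrow> j \<in> J \<Longrightarrow> i \<noteq> j \<Longrightarrow> P i j = \<alpha> \<and> Q i j = \<beta>"
proof -
  let ?M = "ramsey4 k"
  define c where "c e = (if P (Suc (Min e)) (Suc (Max e)) then 2 else 0) +
    (if Q (Suc (Min e)) (Suc (Max e)) then 1 else (0::nat))" for e
  have c: "c {i, j} = (if P (Suc i) (Suc j) then 2 else 0) + (if Q (Suc i) (Suc j) then 1 else 0)"
    for i j
    using sym by (cases "i \<le> j") (auto simp: c_def min_def max_def)
  have "partn_lst {..<?M} [k, k, k, k] 2"
    unfolding ramsey4_def using ramsey_full by (rule LeastI_ex)
  moreover have "c \<in> nsets {..<?M} 2 \<rightarrow> {..<length [k, k, k, k]}"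
    by (auto simp: c_def)
  ultimately have "\<exists>i < length [k, k, k, k]. monochromatic {..<?M} ([k, k, k, k] ! i) 2 c i"
    unfolding partn_lst_def by (rule bspec)
  then obtain i where i': "i < length [k, k, k, k]"
    and mono: "monochromatic {..<?M} ([k, k, k, k] ! i) 2 c i"
    by blast
  have i: "i < 4" using i' by simp
  hence "[k, k, k, k] ! i = k" by (auto simp: less_Suc_eq numeral_eq_Suc)
  then obtain H where H: "H \<in> nsets {..<?M} k" "c ` nsets H 2 \<subseteq> {i}"
    using mono by (auto simp: monochromatic_def)
  have ci: "c {x, y} = i" if "x \<in> H" "y \<in> H" "x \<noteq> y" for x y
  proof -
    have "{x, y} \<in> nsets H 2" using that by simp
    thus ?thesis using H(2) by blast
  qed
  show ?thesis
  proof (rule that[of "Suc ` H" "i \<ge> 2" "odd i"])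
    show "Suc ` H \<subseteq> {1..?M}" "card (Suc ` H) = k"
      using H(1) by (auto simp: nsets_def card_image)
    fix x y assume "x \<in> Suc ` H" "y \<in> Suc ` H" "x \<noteq> y"
    then obtain x' y' where "x' \<in> H" "y' \<in> H" "x' \<noteq> y'" "x = Suc x'" "y = Suc y'" by auto
    thus "P x y = (i \<ge> 2) \<and> Q x y = odd i"
      using ci[of x' y'] c[of x' y'] by (auto split: if_splits)
  qed
qed

lemma ramsey4_ge: "k \<le> ramsey4 k"
proof -
  obtain J where "J \<subseteq> {1..ramsey4 k}" "card J = k"
    using ramsey4_two_relations[of "\<lambda>_ _. True" "\<lambda>_ _. True" k] by blast
  thus ?thesis using card_mono[of "{1..ramsey4 k}" J] by simp
qed

lemma strict_mono_into:
  fixes K J :: "nat set"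
  assumes "finite K" "finite J" "card K \<le> card J"
  obtains h where "\<And>i. i \<in> K \<Longrightarrow> h i \<in> J" "\<And>i j. i \<in> K \<Longrightarrow> j \<in> K \<Longrightarrow> i < j \<Longrightarrow> h i < h j"
proof -
  obtain e where e: "bij_betw e {..<card K} K" "strict_mono_on {..<card K} e"
    using ex_bij_betw_strict_mono_card[OF assms(1)] by blast
  obtain g where g: "bij_betw g {..<card J} J" "strict_mono_on {..<card J} g"
    using ex_bij_betw_strict_mono_card[OF assms(2)] by blast
  define r where "r = inv_into {..<card K} e"
  have r: "r i < card K" "e (r i) = i" if "i \<in> K" for i
    using e(1) that inv_into_into[of i e "{..<card K}"] f_inv_into_f[of i e "{..<card K}"]
    by (auto simp: r_def bij_betw_def)
  have mono: "r i < r j" if "i \<in> K" "j \<in> K" "i < j" for i j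
  proof (rule ccontr)
    assume "\<not> r i < r j"
    hence "r j < r i \<or> r j = r i" by auto
    hence "e (r j) \<le> e (r i)"
      using strict_mono_onD[OF e(2), of "r j" "r i"] r(1)[OF that(1)] r(1)[OF that(2)] by auto
    thus False using r that by simp
  qed
  have "g (r i) < g (r j)" if "i \<in> K" "j \<in> K" "i < j" for i j
  proof -
    have "r i < card J" "r j < card J"
      using r(1)[OF that(1)] r(1)[OF that(2)] assms(3) by linarith+
    thus ?thesis using strict_mono_onD[OF g(2), of "r i" "r j"] mono[OF that] by simp
  qed
  moreover have "g (r i) \<in> J" if "i \<in> K" for i
    using g(1) r(1)[OF that] assms(3) by (auto simp: bij_betw_def)
  ultimately show ?thesis using that[of "\<lambda>i. g (r i)"] by blast
qed

text \<open>The vertices of the blow-up graph are numbered so that \<open>v div Suc k\<close> is the index of \<open>v\<close>;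
  each index owns \<open>k\<close> copies of \<open>x\<close> followed by a single \<open>y\<close>.\<close>

definition blow_up_adj ::
  "(nat \<Rightarrow> nat \<Rightarrow> bool) \<Rightarrow> bool \<Rightarrow> bool \<Rightarrow> bool \<Rightarrow> nat \<Rightarrow> nat \<Rightarrow> nat \<Rightarrow> bool" where
  "blow_up_adj R \<alpha> \<beta> \<gamma> k v v' \<longleftrightarrow>
    (let i = v div Suc k; i' = v' div Suc k; y = (v mod Suc k = k); y' = (v' mod Suc k = k)
     in if y then (if y' then \<beta> else R i' i)
        else (if y' then R i i' else if i = i' then \<gamma> else \<alpha>))"

definition blow_up :: "(nat \<Rightarrow> nat \<Rightarrow> bool) \<Rightarrow> bool \<Rightarrow> bool \<Rightarrow> bool \<Rightarrow> nat \<Rightarrow> nat \<Rightarrow> nat graph" where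
  "blow_up R \<alpha> \<beta> \<gamma> k n = ({..<n * Suc k},
    {{v, v'} | v v'. v < n * Suc k \<and> v' < n * Suc k \<and> v \<noteq> v' \<and> blow_up_adj R \<alpha> \<beta> \<gamma> k v v'})"

lemma adj_blow_up:
  "adj (blow_up R \<alpha> \<beta> \<gamma> k n) v v' \<longleftrightarrow>
     v < n * Suc k \<and> v' < n * Suc k \<and> v \<noteq> v' \<and> blow_up_adj R \<alpha> \<beta> \<gamma> k v v'"
proof -
  have "blow_up_adj R \<alpha> \<beta> \<gamma> k v v' = blow_up_adj R \<alpha> \<beta> \<gamma> k v' v"
    by (auto simp: blow_up_adj_def Let_def)
  thus ?thesis by (auto simp: blow_up_def doubleton_eq_iff)
qed

text \<open>As the pattern is not constant, the \<open>y\<close>-vertices with two given indices tell apart the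
  \<open>x\<close>-vertices with these indices.\<close>

lemma blow_up_distinguished:
  assumes "\<not> (lt = eq \<and> eq = gt)"
  obtains X U where "X \<subseteq> verts (blow_up (compare lt eq gt) \<alpha> \<beta> \<gamma> k n)"
    "distinguished_by (blow_up (compare lt eq gt) \<alpha> \<beta> \<gamma> k n) X n U" "\<And>i. i \<in> {1..n} \<Longrightarrow> card (U i) = k"
proof -
  let ?R = "compare lt eq gt"
  let ?G = "blow_up ?R \<alpha> \<beta> \<gamma> k n"
  define X where "X = (\<lambda>i. i * Suc k + k) ` {..<n}"
  \<comment> \<open>The indices of the blow-up graph start at 0, those of the distinguished sets at 1.\<close>
  define U where "U i = (\<lambda>c. (i - 1) * Suc k + c) ` {..<k}" for i
  have lt: "i * Suc k + c < n * Suc k" if "i < n" "c \<le> k" for i c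
  proof -
    have "i * Suc k + c < Suc i * Suc k" using that(2) by simp
    also have "\<dots> \<le> n * Suc k" using that(1) by (intro mult_le_mono1) simp
    finally show ?thesis .
  qed
  have dm: "(i * Suc k + c) div Suc k = i" "(i * Suc k + c) mod Suc k = c" if "c \<le> k" for i c
    using that by (simp_all del: mult_Suc_right)
  have nbhd: "i * Suc k + k \<in> nbhd ?G x \<inter> X \<longleftrightarrow> ?R (j - 1) i"
    if "j \<in> {1..n}" "x \<in> U j" "i < n" for i j x
  proof -
    obtain c where c: "x = (j - 1) * Suc k + c" "c < k"
      using \<open>x \<in> U j\<close> by (auto simp: U_def)
    have x: "x < n * Suc k" "x div Suc k = j - 1" "x mod Suc k = c"
      using lt[of "j - 1" c] dm[of c "j - 1"] c that(1) by auto
    have y: "i * Suc k + k < n * Suc k" "(i * Suc k + k) div Suc k = i" "(i * Suc k + k) mod Suc k = k"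
      using lt[of i k] dm[of k i] that(3) by auto
    have "x \<noteq> i * Suc k + k" using x(3) y(3) c(2) by (auto simp del: mult_Suc_right)
    hence "adj ?G x (i * Suc k + k) \<longleftrightarrow> ?R (j - 1) i"
      using x(1) y(1) c(2) unfolding adj_blow_up blow_up_adj_def x(2,3) y(2,3) Let_def by simp
    moreover have "i * Suc k + k \<in> X" using that(3) by (auto simp: X_def)
    moreover have "i * Suc k + k \<in> verts ?G" using y(1) by (simp add: blow_up_def)
    ultimately show ?thesis by (simp add: nbhd_def)
  qed
  have nbhd_eq: "nbhd ?G x \<inter> X = (\<lambda>i. i * Suc k + k) ` {i \<in> {..<n}. ?R (j - 1) i}"
    if "j \<in> {1..n}" "x \<in> U j" for j x
    using nbhd[OF that] by (auto simp: X_def)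
  have idx: "x div Suc k = i - 1" if "x \<in> U i" for x i
    using that dm(1) by (auto simp: U_def)
  show ?thesis
  proof (rule that[of X U])
    show "X \<subseteq> verts ?G" using lt by (auto simp: X_def blow_up_def)
    show "card (U i) = k" for i by (simp add: U_def card_image inj_on_def)
    show "distinguished_by ?G X n U"
      unfolding distinguished_by_def
    proof (intro conjI ballI impI)
      show "U i \<subseteq> verts ?G" if "i \<in> {1..n}" for i
        using lt[of "i - 1"] that by (auto simp: U_def blow_up_def)
      show "disjoint_family_on U {1..n}"
      proof (unfold disjoint_family_on_def, intro ballI impI)
        fix i j assume "i \<in> {1..n}" "j \<in> {1..n}" "i \<noteq> j"
        hence "i - 1 \<noteq> j - 1" by auto
        thus "U i \<inter> U j = {}" using idx by (metis disjoint_iff)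
      qed
      show "nbhd ?G x \<inter> X = nbhd ?G y \<inter> X" if "i \<in> {1..n}" "x \<in> U i" "y \<in> U i" for i x y
        using nbhd_eq that by simp
      fix i j x y assume ij: "i \<in> {1..n}" "j \<in> {1..n}" "i \<noteq> j" and x: "x \<in> U i" and y: "y \<in> U j"
      have l: "i - 1 < n" "j - 1 < n" "i - 1 \<noteq> j - 1" using ij by auto
      show "nbhd ?G x \<inter> X \<noteq> nbhd ?G y \<inter> X"
      proof
        assume "nbhd ?G x \<inter> X = nbhd ?G y \<inter> X"
        hence "?R (i - 1) t \<longleftrightarrow> ?R (j - 1) t" if "t < n" for t
          using nbhd[OF ij(1) x that] nbhd[OF ij(2) y that] by simp
        from this[OF l(1)] this[OF l(2)] show False
          using assms l(3) by (auto simp: compare_def split: if_splits)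
      qed
    qed
  qed
qed

text \<open>A set of \<open>m\<close> vertices of the blow-up graph involves at most \<open>m\<close> indices. Hence the pattern with
  \<open>m\<close> indices, found among the letters, already provides all sets of at most \<open>m\<close> vertices of
  arbitrarily large blow-ups. Only the \<open>x\<close>-letters are repeated, so only their loops matter.\<close>

lemma blow_up_in_Free:
  fixes D :: "nat \<Rightarrow> nat \<Rightarrow> bool"
  assumes small: "\<forall>F\<in>\<F>. simple_graph F \<and> card (verts F) \<le> m"
    and copies: "has_copies (Free \<F>) D u N"
    and sym: "\<And>a b. D a b \<longleftrightarrow> D b a"
    and J: "finite J" "m \<le> card J" "\<And>i. i \<in> J \<Longrightarrow> xs i \<in> u ` {..<N} \<and> ys i \<in> u ` {..<N}"
    and xx: "\<And>i j. i \<in> J \<Longrightarrow> j \<in> J \<Longrightarrow> i \<noteq> j \<Longrightarrow> D (xs i) (xs j) = \<alpha>"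
    and loop: "\<And>i. i \<in> J \<Longrightarrow> D (xs i) (xs i) = \<gamma>"
    and yy: "\<And>i j. i \<in> J \<Longrightarrow> j \<in> J \<Longrightarrow> i \<noteq> j \<Longrightarrow> D (ys i) (ys j) = \<beta>"
    and xy: "\<And>i j. i \<in> J \<Longrightarrow> j \<in> J \<Longrightarrow> D (xs i) (ys j) \<longleftrightarrow> compare lt eq gt i j"
  shows "blow_up (compare lt eq gt) \<alpha> \<beta> \<gamma> k n \<in> Free \<F>"
    (is "?G \<in> _")
proof (rule Free_localI[OF small])
  show "simple_graph ?G" by (auto simp: simple_graph_def blow_up_def)
  fix W assume W: "W \<subseteq> verts ?G" "card W \<le> m"
  have fW: "finite W" using W(1) by (rule finite_subset) (simp add: blow_up_def)
  let ?i = "\<lambda>v. v div Suc k"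
  have "card (?i ` W) \<le> card J" using card_image_le[OF fW, of ?i] W(2) J(2) by linarith
  then obtain h where h: "\<And>i. i \<in> ?i ` W \<Longrightarrow> h i \<in> J"
    "\<And>i j. i \<in> ?i ` W \<Longrightarrow> j \<in> ?i ` W \<Longrightarrow> i < j \<Longrightarrow> h i < h j"
    using strict_mono_into[of "?i ` W" J] fW J(1) by blast
  define c where "c v = (if v mod Suc k = k then ys (h (?i v)) else xs (h (?i v)))" for v
  have "embeds W (adj ?G) W (\<lambda>x y. D (c x) (c y))"
  proof (rule embedsI[of "\<lambda>x. x"])
    fix v v' assume v: "v \<in> W" "v' \<in> W" "v \<noteq> v'"
    have hJ: "h (?i v) \<in> J" "h (?i v') \<in> J" using h(1) v by auto
    have cmp: "compare lt eq gt (h (?i v)) (h (?i v')) = compare lt eq gt (?i v) (?i v')"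
      "compare lt eq gt (h (?i v')) (h (?i v)) = compare lt eq gt (?i v') (?i v)"
      using h(2)[of "?i v" "?i v'"] h(2)[of "?i v'" "?i v"] v
      by (cases "?i v" "?i v'" rule: linorder_cases; auto simp: compare_def)+
    have hne: "h (?i v) \<noteq> h (?i v') \<longleftrightarrow> ?i v \<noteq> ?i v'"
      using h(2)[of "?i v" "?i v'"] h(2)[of "?i v'" "?i v"] v
      by (cases "?i v" "?i v'" rule: linorder_cases; auto)
    have ine: "?i v \<noteq> ?i v'" if "v mod Suc k = v' mod Suc k"
      using that v(3) by (metis div_mult_mod_eq)
    have "adj ?G v v' \<longleftrightarrow> blow_up_adj (compare lt eq gt) \<alpha> \<beta> \<gamma> k v v'"
      using v W(1) unfolding adj_blow_up by (auto simp: blow_up_def)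
    also have "\<dots> \<longleftrightarrow> D (c v) (c v')"
    proof (cases "v mod Suc k = k"; cases "v' mod Suc k = k")
      assume "v mod Suc k = k" "v' mod Suc k = k"
      thus ?thesis using yy[OF hJ] hne ine by (simp add: blow_up_adj_def c_def)
    next
      assume "v mod Suc k = k" "v' mod Suc k \<noteq> k"
      thus ?thesis using xy[OF hJ(2,1)] cmp sym[of "ys (h (?i v))"]
        by (simp add: blow_up_adj_def c_def)
    next
      assume "v mod Suc k \<noteq> k" "v' mod Suc k = k"
      thus ?thesis using xy[OF hJ] cmp by (simp add: blow_up_adj_def c_def)
    next
      assume "v mod Suc k \<noteq> k" "v' mod Suc k \<noteq> k"
      thus ?thesis using xx[OF hJ] loop[OF hJ(1)] hne
        by (cases "?i v = ?i v'") (simp_all add: blow_up_adj_def c_def)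
    qed
    finally show "adj ?G v v' = D (c v) (c v')" .
  qed auto
  moreover have "\<exists>G'\<in>Free \<F>. embeds W (\<lambda>x y. D (c x) (c y)) (verts G') (adj G')"
    by (rule has_copies_blow_up[OF copies fW]) (use h(1) J(3) in \<open>auto simp: c_def\<close>)
  ultimately show "\<exists>G'\<in>Free \<F>. embeds W (adj ?G) (verts G') (adj G')"
    using embeds_trans by blast
qed

text \<open>Hence many letters without twins would make the distinguishing number infinite. Ramsey's
  theorem makes the pattern homogeneous on \<open>2 * m - 1\<close> indices up to loops, and at least \<open>m\<close> of these
  agree on the loops of their \<open>x\<close>-letters.\<close>

lemma card_letters_le:
  fixes D :: "nat \<Rightarrow> nat \<Rightarrow> bool"
  assumes small: "\<forall>F\<in>\<F>. simple_graph F \<and> card (verts F) \<le> m" and "2 \<le> m"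
    and f: "unavoidable_bound f" and M: "M = ramsey4 (2 * m - 1)"
    and fin: "finite_distinguishing_number (Free \<F>)"
    and copies: "has_copies (Free \<F>) D u N"
    and sym: "\<And>a b. D a b \<longleftrightarrow> D b a"
    and twins: "inj_on (\<lambda>a. {b \<in> u ` {..<N}. D a b}) (u ` {..<N})"
  shows "card (u ` {..<N}) \<le> f M M M"
proof (rule ccontr)
  assume "\<not> card (u ` {..<N}) \<le> f M M M"
  moreover have "3 \<le> M" using ramsey4_ge[of "2 * m - 1"] \<open>2 \<le> m\<close> M by linarith
  ultimately obtain xs ys lt eq gt where pat: "\<not> (lt = eq \<and> eq = gt)"
    "\<And>i. i \<in> {1..M} \<Longrightarrow> xs i \<in> u ` {..<N} \<and> ys i \<in> u ` {..<N}"
    "\<And>i j. i \<in> {1..M} \<Longrightarrow> j \<in> {1..M} \<Longrightarrow> D (xs i) (ys j) \<longleftrightarrow> compare lt eq gt i j"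
    using letters_with_pattern[OF f _ _ _ sym twins, of M] by (metis finite_imageI finite_lessThan nle_le)
  obtain J \<alpha> \<beta> where J: "J \<subseteq> {1..M}" "card J = 2 * m - 1"
    "\<And>i j. i \<in> J \<Longrightarrow> j \<in> J \<Longrightarrow> i \<noteq> j \<Longrightarrow> D (xs i) (xs j) = \<alpha> \<and> D (ys i) (ys j) = \<beta>"
    using ramsey4_two_relations[of "\<lambda>i j. D (xs i) (xs j)" "\<lambda>i j. D (ys i) (ys j)" "2 * m - 1"] sym M
    by blast
  have fJ: "finite J" using J(1) finite_subset by blast
  define L where "L \<gamma> = {i \<in> J. D (xs i) (xs i) = \<gamma>}" for \<gamma>
  have "J = L True \<union> L False" "L True \<inter> L False = {}" by (auto simp: L_def)
  hence "card (L True) + card (L False) = 2 * m - 1"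
    using J(2) fJ by (metis card_Un_disjoint finite_Un)
  hence "m \<le> card (L True) \<or> m \<le> card (L False)" by linarith
  then obtain \<gamma> where \<gamma>: "m \<le> card (L \<gamma>)" by blast
  have "blow_up (compare lt eq gt) \<alpha> \<beta> \<gamma> k n \<in> Free \<F>" for k n
    by (rule blow_up_in_Free[OF small copies sym, of "L \<gamma>" xs ys])
      (use \<gamma> fJ J pat in \<open>auto simp: L_def subset_iff\<close>)
  hence "infinite_distinguishing_number (Free \<F>)"
    unfolding infinite_distinguishing_number_def
    by (metis blow_up_distinguished[OF pat(1)] order_refl)
  thus False using fin by (simp add: finite_distinguishing_number_def)
qed

section \<open>Sparsification\<close>

text \<open>The edges at which a graph deviates from the adjacency \<open>D\<close> prescribed by the types \<open>\<tau>\<close> of the end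
  vertices, outside an exceptional set \<open>R\<close>. In a decomposition, \<open>D\<close> lives on the \<open>t\<close> types only, so that
  there are finitely many choices for it.\<close>

definition deviates ::
  "nat graph \<Rightarrow> nat set \<Rightarrow> (nat \<Rightarrow> nat) \<Rightarrow> (nat \<Rightarrow> nat \<Rightarrow> bool) \<Rightarrow> nat \<Rightarrow> nat \<Rightarrow> bool" where
  "deviates G R \<tau> D x y \<longleftrightarrow> x \<in> verts G - R \<and> y \<in> verts G - R \<and> x \<noteq> y \<and> adj G x y \<noteq> D (\<tau> x) (\<tau> y)"

definition sparse_decomposition :: "nat \<Rightarrow> nat \<Rightarrow> nat \<Rightarrow>
  nat graph \<Rightarrow> nat set \<Rightarrow> (nat \<Rightarrow> nat) \<Rightarrow> (nat \<Rightarrow> nat \<Rightarrow> bool) \<Rightarrow> bool" where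
  "sparse_decomposition c t \<Delta> G R \<tau> D \<longleftrightarrow> R \<subseteq> verts G \<and> card R \<le> c \<and> (\<forall>x. \<tau> x < t) \<and>
     (\<forall>a b. D a b \<longrightarrow> a < t \<and> b < t) \<and> (\<forall>a b. D a b \<longleftrightarrow> D b a) \<and>
     (\<forall>x. card {y. deviates G R \<tau> D x y} \<le> \<Delta>)"

lemma deviates_sym:
  assumes "sparse_decomposition c t \<Delta> G R \<tau> D"
  shows "deviates G R \<tau> D x y \<longleftrightarrow> deviates G R \<tau> D y x"
  using assms by (auto simp: deviates_def sparse_decomposition_def insert_commute)

lemma card_UN_le_mult:
  assumes "finite I" "\<And>i. i \<in> I \<Longrightarrow> card (A i) \<le> b"
  shows "card (\<Union>i\<in>I. A i) \<le> card I * b"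
  using card_UN_le[OF assms(1), of A] sum_bounded_above[of I "\<lambda>i. card (A i)" b] assms(2) by simp

locale graph_traces =
  fixes G :: "nat graph"
  assumes simple: "simple_graph G"
begin

definition cls :: "nat set \<Rightarrow> nat set \<Rightarrow> nat set" where
  "cls X T = {v \<in> verts G. nbhd G v \<inter> X = T}"

definition big :: "nat set \<Rightarrow> nat \<Rightarrow> nat set set" where
  "big X s = {T. T \<subseteq> X \<and> s \<le> card (cls X T)}"

lemma finite_verts: "finite (verts G)"
  using simple by (simp add: simple_graph_def)

lemma finite_cls: "finite (cls X T)"
  using finite_verts by (simp add: cls_def)

lemma finite_big: "finite X \<Longrightarrow> finite (big X s)"
  by (simp add: big_def)

lemma nbhd_sym: "x \<in> verts G \<Longrightarrow> y \<in> verts G \<Longrightarrow> x \<in> nbhd G y \<longleftrightarrow> y \<in> nbhd G x"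
  by (auto simp: nbhd_def insert_commute)

lemma big_distinguished:
  assumes "X \<subseteq> verts G"
  obtains U where "distinguished_by G X (card (big X s)) U"
    "\<And>i. i \<in> {1..card (big X s)} \<Longrightarrow> s \<le> card (U i)"
proof -
  have "finite (big X s)" using assms finite_verts finite_big finite_subset by blast
  then obtain h where h: "bij_betw h {1..card (big X s)} (big X s)"
    using ex_bij_betw_nat_finite_1 by blast
  have hb: "h i \<in> big X s" if "i \<in> {1..card (big X s)}" for i
    using h that by (auto simp: bij_betw_def)
  have hi: "h i \<noteq> h j" if "i \<in> {1..card (big X s)}" "j \<in> {1..card (big X s)}" "i \<noteq> j" for i j
    using h that by (auto simp: bij_betw_def dest: inj_onD)
  show ?thesis
  proof (rule that[of "\<lambda>i. cls X (h i)"])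
    show "distinguished_by G X (card (big X s)) (\<lambda>i. cls X (h i))"
      unfolding distinguished_by_def disjoint_family_on_def cls_def using hi by auto
    show "s \<le> card (cls X (h i))" if "i \<in> {1..card (big X s)}" for i
      using hb[OF that] by (simp add: big_def)
  qed
qed

text \<open>Adding \<open>v\<close> to \<open>X\<close> splits every class into its neighbours and non-neighbours of \<open>v\<close>; the larger half
  of a class keeps half of its size. So if one class is split into two large halves, the number of
  large classes grows, at the price of halving the size.\<close>

lemma card_big_insert:
  assumes "finite X" "v \<in> verts G" "T \<in> big X (2 * d)" "0 < d"
    and halves: "d \<le> card (cls X T \<inter> nbhd G v)" "d \<le> card (cls X T - nbhd G v)"
  shows "Suc (card (big X (2 * d))) \<le> card (big (insert v X) d)"
proof -
  have "v \<notin> X"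
  proof
    assume "v \<in> X"
    have "cls X T \<inter> nbhd G v = {} \<or> cls X T - nbhd G v = {}"
    proof (cases "v \<in> T")
      case True
      hence "cls X T - nbhd G v = {}" using nbhd_sym[OF \<open>v \<in> verts G\<close>] by (auto simp: cls_def)
      thus ?thesis by simp
    next
      case False
      hence "cls X T \<inter> nbhd G v = {}"
        using nbhd_sym[OF \<open>v \<in> verts G\<close>] \<open>v \<in> X\<close> by (auto simp: cls_def)
      thus ?thesis by simp
    qed
    hence "card (cls X T \<inter> nbhd G v) = 0 \<or> card (cls X T - nbhd G v) = 0"
      by (metis card.empty)
    thus False using halves \<open>0 < d\<close> by linarith
  qed
  have out: "cls (insert v X) S = cls X S - nbhd G v" if "S \<subseteq> X" for S
    using that \<open>v \<notin> X\<close> nbhd_sym[OF \<open>v \<in> verts G\<close>] by (auto simp: cls_def)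
  have inn: "cls (insert v X) (insert v S) = cls X S \<inter> nbhd G v" if "S \<subseteq> X" for S
  proof -
    have "Y \<inter> insert v X = insert v S \<longleftrightarrow> v \<in> Y \<and> Y \<inter> X = S" for Y
      using that \<open>v \<notin> X\<close> by (cases "v \<in> Y") (auto simp: insert_ident subset_iff)
    thus ?thesis using nbhd_sym[OF \<open>v \<in> verts G\<close>] by (auto simp: cls_def)
  qed
  define g where "g S = (if d \<le> card (cls X S - nbhd G v) then S else insert v S)" for S
  have g: "g S \<in> big (insert v X) d" if "S \<in> big X (2 * d)" for S
  proof -
    have S: "S \<subseteq> X" "2 * d \<le> card (cls X S)" using that by (auto simp: big_def)
    have "card (cls X S) = card (cls X S \<inter> nbhd G v) + card (cls X S - nbhd G v)"
      using card_Int_Diff[OF finite_cls] by blast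
    thus ?thesis using S out[OF S(1)] inn[OF S(1)] by (auto simp: g_def big_def)
  qed
  have gX: "g S \<inter> X = S" if "S \<in> big X (2 * d)" for S
    using that \<open>v \<notin> X\<close> by (auto simp: g_def big_def)
  hence "inj_on g (big X (2 * d))" by (metis inj_onI)
  hence card_g: "card (g ` big X (2 * d)) = card (big X (2 * d))" by (rule card_image)
  have T: "T \<subseteq> X" using assms(3) by (simp add: big_def)
  have "insert v T \<notin> g ` big X (2 * d)"
  proof
    assume "insert v T \<in> g ` big X (2 * d)"
    then obtain S where S: "S \<in> big X (2 * d)" "insert v T = g S" by blast
    hence "S = insert v T \<inter> X" using gX[OF S(1)] by simp
    hence "S = T" using T \<open>v \<notin> X\<close> by auto
    thus False using S(2) halves(2) T \<open>v \<notin> X\<close> by (auto simp: g_def)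
  qed
  moreover have "insert v T \<in> big (insert v X) d"
    using T inn[OF T] halves(1) by (auto simp: big_def)
  moreover have fin: "finite (big (insert v X) d)" using \<open>finite X\<close> by (simp add: finite_big)
  ultimately have "card (insert (insert v T) (g ` big X (2 * d))) \<le> card (big (insert v X) d)"
    using g by (intro card_mono) auto
  moreover have "card (insert (insert v T) (g ` big X (2 * d))) = Suc (card (big X (2 * d)))"
    using \<open>insert v T \<notin> g ` big X (2 * d)\<close> card_g finite_big[OF \<open>finite X\<close>] by simp
  ultimately show ?thesis by simp
qed

text \<open>Take the largest possible number \<open>p\<close> of large classes obtainable from at most \<open>p\<close> vertices, where the
  threshold for being large is halved whenever \<open>p\<close> grows by one. Then no vertex splits a large class
  any more, and since \<open>X\<close> is small, there are few other classes.\<close>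

lemma unsplittable_classes:
  assumes few: "\<And>X. X \<subseteq> verts G \<Longrightarrow> card (big X k) < l" and "0 < k"
  obtains X d where "X \<subseteq> verts G" "card X < l" "0 < d" "d \<le> 2 ^ l * k" "card (big X d) < l"
    "\<And>v T. v \<in> verts G \<Longrightarrow> T \<in> big X d \<Longrightarrow>
      card (cls X T \<inter> nbhd G v) < d \<or> card (cls X T - nbhd G v) < d"
proof -
  define good where "good p \<longleftrightarrow> (\<exists>X\<subseteq>verts G. card X \<le> p \<and> p \<le> card (big X (2 ^ (l - p) * k)))" for p
  have "good 0" by (auto simp: good_def)
  have notgood: "\<not> good l" using few by (auto simp: good_def not_le)
  have "\<exists>p<l. good p \<and> \<not> good (Suc p)"
  proof (rule ccontr)
    assume "\<not> ?thesis"
    hence "p \<le> l \<Longrightarrow> good p" for p by (induction p) (use \<open>good 0\<close> in auto)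
    thus False using notgood by blast
  qed
  then obtain p where p: "p < l" "good p" "\<not> good (Suc p)" by blast
  define d where "d = 2 ^ (l - Suc p) * k"
  have "l - p = Suc (l - Suc p)" using p by simp
  hence d2: "2 ^ (l - p) * k = 2 * d" by (simp add: d_def)
  obtain X where X: "X \<subseteq> verts G" "card X \<le> p" "p \<le> card (big X (2 * d))"
    using p(2) unfolding good_def d2 by blast
  have fX: "finite X" using X(1) finite_verts finite_subset by blast
  have less: "card (big X' d) < Suc p" if "X' \<subseteq> verts G" "card X' \<le> Suc p" for X'
    using p(3) that unfolding good_def d_def[symmetric] by (meson not_less)
  have sub: "big X (2 * d) \<subseteq> big X d" by (auto simp: big_def)
  have "card (big X d) \<le> card (big X (2 * d))" using less[OF X(1)] X by simp
  hence eq: "big X (2 * d) = big X d" by (rule card_seteq[OF finite_big[OF fX] sub])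
  have "0 < d" using \<open>0 < k\<close> by (simp add: d_def)
  show ?thesis
  proof (rule that[of X d])
    show "d \<le> 2 ^ l * k" by (simp add: d_def)
    show "card (big X d) < l" using less[OF X(1)] X(2) p(1) by simp
    fix v T assume v: "v \<in> verts G" and T: "T \<in> big X d"
    show "card (cls X T \<inter> nbhd G v) < d \<or> card (cls X T - nbhd G v) < d"
    proof (rule ccontr)
      assume "\<not> ?thesis"
      hence "Suc (card (big X (2 * d))) \<le> card (big (insert v X) d)"
        using card_big_insert[OF fX v _ \<open>0 < d\<close>] T eq by (simp add: not_less)
      moreover have "card (insert v X) \<le> Suc p" using X(2) fX by (simp add: card_insert_if)
      ultimately show False using less[of "insert v X"] X v by simp
    qed
  qed (use X p \<open>0 < d\<close> in auto)
qed

text \<open>The type of a vertex records its class and the classes to which it is almost completely joined.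
  Types with few vertices are discarded. Between two remaining types, being almost completely joined
  is symmetric: otherwise some vertex of the second type would be adjacent to \<open>d\<close> vertices of the
  first type, although it has fewer than \<open>d\<close> neighbours in their class.\<close>

lemma sparse_decomposition_exists:
  assumes few: "\<And>X. X \<subseteq> verts G \<Longrightarrow> card (big X k) < l" and "0 < k"
  defines "K \<equiv> 2 ^ l * k"
  shows "\<exists>R \<tau> D. sparse_decomposition (2 ^ l * K + l * 2 ^ l * (K * K)) (Suc (l * 2 ^ l)) (l * K) G R \<tau> D"
proof -
  obtain X d where X: "X \<subseteq> verts G" "card X < l" and d: "0 < d" "d \<le> K" and Bl: "card (big X d) < l"
    and split: "\<And>v T. v \<in> verts G \<Longrightarrow> T \<in> big X d \<Longrightarrow>
      card (cls X T \<inter> nbhd G v) < d \<or> card (cls X T - nbhd G v) < d"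
    using unsplittable_classes[OF few \<open>0 < k\<close>] unfolding K_def by blast
  define B where "B = big X d"
  have fX: "finite X" using X(1) finite_verts finite_subset by blast
  have fB: "finite B" using fX by (simp add: B_def finite_big)
  define tr where "tr v = nbhd G v \<inter> X" for v
  have trX: "tr v \<subseteq> X" for v by (simp add: tr_def)
  define dense where "dense v T \<longleftrightarrow> card (cls X T - nbhd G v) < d" for v T
  define ty where "ty v = (tr v, {T \<in> B. dense v T})" for v
  define Ty where "Ty = B \<times> Pow B"
  define same where "same \<sigma> = {w \<in> verts G. ty w = \<sigma>}" for \<sigma>
  define R where "R = {v \<in> verts G. tr v \<notin> B} \<union> {v \<in> verts G. tr v \<in> B \<and> card (same (ty v)) < d * d}"
  have fTy: "finite Ty" using fB by (simp add: Ty_def)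
  have cTy: "card Ty \<le> l * 2 ^ l"
  proof -
    have "card Ty = card B * 2 ^ card B" using fB by (simp add: Ty_def card_cartesian_product card_Pow)
    also have "\<dots> \<le> l * 2 ^ l" using Bl by (intro mult_le_mono) (auto simp: B_def)
    finally show ?thesis .
  qed
  have tyTy: "ty v \<in> Ty" if "tr v \<in> B" for v using that by (auto simp: ty_def Ty_def)
  have cR: "card R \<le> 2 ^ l * K + l * 2 ^ l * (K * K)"
  proof -
    have "{v \<in> verts G. tr v \<notin> B} \<subseteq> (\<Union>T\<in>Pow X - B. cls X T)"
      by (auto simp: cls_def tr_def)
    hence "card {v \<in> verts G. tr v \<notin> B} \<le> card (\<Union>T\<in>Pow X - B. cls X T)"
      using fX finite_cls by (intro card_mono) auto
    also have "\<dots> \<le> card (Pow X - B) * K"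
      using fX d by (intro card_UN_le_mult) (auto simp: B_def big_def)
    also have "card (Pow X - B) \<le> 2 ^ card X" using fX by (metis Diff_subset card_Pow card_mono finite_Pow_iff)
    also have "(2::nat) ^ card X \<le> 2 ^ l" using X(2) by simp
    finally have 1: "card {v \<in> verts G. tr v \<notin> B} \<le> 2 ^ l * K" by simp
    let ?I = "{\<sigma> \<in> Ty. card (same \<sigma>) < d * d}"
    have "{v \<in> verts G. tr v \<in> B \<and> card (same (ty v)) < d * d} \<subseteq> (\<Union>\<sigma>\<in>?I. same \<sigma>)"
      using tyTy by (auto simp: same_def)
    hence "card {v \<in> verts G. tr v \<in> B \<and> card (same (ty v)) < d * d} \<le> card (\<Union>\<sigma>\<in>?I. same \<sigma>)"
      using fTy finite_verts by (intro card_mono) (auto simp: same_def)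
    also have "\<dots> \<le> card ?I * (d * d)"
      using fTy by (intro card_UN_le_mult) auto
    also have "\<dots> \<le> l * 2 ^ l * (K * K)"
    proof (rule mult_le_mono)
      have "card ?I \<le> card Ty" using fTy by (intro card_mono) auto
      thus "card ?I \<le> l * 2 ^ l" using cTy by simp
      show "d * d \<le> K * K" using d by (intro mult_le_mono)
    qed
    finally have 2: "card {v \<in> verts G. tr v \<in> B \<and> card (same (ty v)) < d * d} \<le> l * 2 ^ l * (K * K)" .
    show ?thesis unfolding R_def using card_Un_le 1 2 by (meson add_mono order_trans)
  qed
  \<comment> \<open>Any \<open>d\<close> vertices of one type miss at most \<open>d * (d - 1)\<close> vertices of the other, whence the bound
    \<open>d * d\<close> for discarding a type.\<close>
  have dense_sym: "dense y (tr x)"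
    if xy: "x \<in> verts G - R" "y \<in> verts G - R" "dense x (tr y)" for x y
  proof -
    have large: "d * d \<le> card (same (ty x))" "d * d \<le> card (same (ty y))"
      and B: "tr x \<in> B" "tr y \<in> B"
      using xy by (auto simp: R_def)
    have "d \<le> card (same (ty x))" using large(1) d(1) by (meson le_square order_trans)
    then obtain W where W: "W \<subseteq> same (ty x)" "card W = d" "finite W"
      using obtain_subset_with_card_n by metis
    have W2: "w \<in> verts G" "tr w = tr x" "card (cls X (tr y) - nbhd G w) < d" if "w \<in> W" for w
    proof -
      have "w \<in> same (ty x)" using W(1) that by blast
      hence w: "w \<in> verts G" "tr w = tr x" "{T \<in> B. dense w T} = {T \<in> B. dense x T}"
        by (auto simp: same_def ty_def)
      thus "w \<in> verts G" "tr w = tr x" by auto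
      have "tr y \<in> {T \<in> B. dense w T}" using w(3) xy(3) B(2) by simp
      thus "card (cls X (tr y) - nbhd G w) < d" by (simp add: dense_def)
    qed
    let ?N = "\<Union>w\<in>W. cls X (tr y) - nbhd G w"
    have "card ?N \<le> card W * (d - 1)"
      using W(3) W2(3) d(1) by (intro card_UN_le_mult) force+
    also have "\<dots> < d * d" using W(2) d(1) by simp
    finally have "card ?N < card (same (ty y))" using large(2) by simp
    hence "\<not> same (ty y) \<subseteq> ?N"
      using card_mono[of ?N "same (ty y)"] W(3) finite_cls by auto
    then obtain z where z: "z \<in> same (ty y)" "z \<notin> ?N" by blast
    hence zy: "z \<in> verts G" "tr z = tr y" "{T \<in> B. dense z T} = {T \<in> B. dense y T}"
      by (auto simp: same_def ty_def)
    hence "z \<in> cls X (tr y)" by (auto simp: cls_def tr_def)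
    hence "W \<subseteq> cls X (tr x) \<inter> nbhd G z"
      using z(2) W2(1,2) nbhd_sym[OF zy(1)] by (auto simp: cls_def tr_def)
    hence "d \<le> card (cls X (tr x) \<inter> nbhd G z)"
      using W(2) finite_cls by (metis card_mono finite_Int)
    hence "dense z (tr x)" using split[OF zy(1)] B(1) by (force simp: dense_def B_def)
    hence "tr x \<in> {T \<in> B. dense y T}" using zy(3) B(1) by blast
    thus ?thesis by simp
  qed
  obtain e where e: "bij_betw e Ty {0..<card Ty}"
    using ex_bij_betw_finite_nat[OF fTy] by blast
  define \<tau> where "\<tau> v = (if tr v \<in> B then e (ty v) else 0)" for v
  have tau: "\<tau> v < Suc (l * 2 ^ l)" for v
  proof (cases "tr v \<in> B")
    case True
    hence "e (ty v) < card Ty" using e tyTy by (force simp: bij_betw_def)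
    thus ?thesis using cTy by (simp add: \<tau>_def)
  qed (simp add: \<tau>_def)
  have tau_inj: "ty x = ty y" if "\<tau> x = \<tau> y" "x \<in> verts G - R" "y \<in> verts G - R" for x y
  proof -
    have "tr x \<in> B" "tr y \<in> B" using that by (auto simp: R_def)
    thus ?thesis using that(1) e tyTy unfolding \<tau>_def bij_betw_def by (auto dest: inj_onD)
  qed
  define D where "D a b \<longleftrightarrow> (\<exists>x\<in>verts G - R. \<exists>y\<in>verts G - R. a = \<tau> x \<and> b = \<tau> y \<and> dense x (tr y))" for a b
  have D: "D (\<tau> x) (\<tau> y) \<longleftrightarrow> dense x (tr y)" if xy: "x \<in> verts G - R" "y \<in> verts G - R" for x y
  proof
    assume "D (\<tau> x) (\<tau> y)"
    then obtain x' y' where x': "x' \<in> verts G - R" "\<tau> x = \<tau> x'" and y': "y' \<in> verts G - R" "\<tau> y = \<tau> y'"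
      and dn: "dense x' (tr y')" unfolding D_def by blast
    have "ty x = ty x'" "ty y = ty y'" 
      using tau_inj[OF x'(2) xy(1) x'(1)] tau_inj[OF y'(2) xy(2) y'(1)] by blast+
    moreover have "tr y' \<in> B" using y' by (auto simp: R_def)
    ultimately show "dense x (tr y)" using dn by (auto simp: ty_def)
  qed (use xy in \<open>auto simp: D_def\<close>)
  have deg: "card {y. deviates G R \<tau> D x y} \<le> l * K" for x
  proof (cases "x \<in> verts G - R")
    case True
    let ?A = "\<lambda>T. if dense x T then cls X T - nbhd G x else cls X T \<inter> nbhd G x"
    have "y \<in> (\<Union>T\<in>B. ?A T)" if "deviates G R \<tau> D x y" for y
    proof -
      have y: "y \<in> verts G - R" "adj G x y \<noteq> dense x (tr y)" using that D by (auto simp: deviates_def)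
      hence "tr y \<in> B" by (auto simp: R_def)
      moreover have "y \<in> ?A (tr y)" using y by (auto simp: cls_def tr_def nbhd_def)
      ultimately show ?thesis by blast
    qed
    hence "{y. deviates G R \<tau> D x y} \<subseteq> (\<Union>T\<in>B. ?A T)" by blast
    moreover have "finite (\<Union>T\<in>B. ?A T)" using fB finite_cls by simp
    ultimately have "card {y. deviates G R \<tau> D x y} \<le> card (\<Union>T\<in>B. ?A T)" by (intro card_mono)
    also have "\<dots> \<le> card B * K"
    proof (rule card_UN_le_mult[OF fB])
      show "card (?A T) \<le> K" if "T \<in> B" for T
        using split[of x T] that True d(2) by (auto simp: dense_def B_def)
    qed
    also have "\<dots> \<le> l * K" using Bl by (intro mult_le_mono) (auto simp: B_def)
    finally show ?thesis .
  next
    case False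
    hence "{y. deviates G R \<tau> D x y} = {}" by (auto simp: deviates_def)
    thus ?thesis by simp
  qed
  have "sparse_decomposition (2 ^ l * K + l * 2 ^ l * (K * K)) (Suc (l * 2 ^ l)) (l * K) G R \<tau> D"
    unfolding sparse_decomposition_def
  proof (intro conjI allI impI)
    show "R \<subseteq> verts G" by (auto simp: R_def)
    show "D a b \<longleftrightarrow> D b a" for a b using dense_sym unfolding D_def by blast
    show "a < Suc (l * 2 ^ l)" "b < Suc (l * 2 ^ l)" if "D a b" for a b
      using that tau unfolding D_def by blast+
  qed (use cR tau deg in auto)
  thus ?thesis by blast
qed

end

theorem finite_distinguishing_sparse_decomposition:
  assumes "finite_distinguishing_number \<C>" "\<And>G. G \<in> \<C> \<Longrightarrow> simple_graph G"
  obtains c t \<Delta> where "\<And>G. G \<in> \<C> \<Longrightarrow> \<exists>R \<tau> D. sparse_decomposition c t \<Delta> G R \<tau> D"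
proof -
  obtain k l where kl: "\<And>G X p U. G \<in> \<C> \<Longrightarrow> X \<subseteq> verts G \<Longrightarrow> l \<le> p \<Longrightarrow> distinguished_by G X p U \<Longrightarrow>
      \<exists>i\<in>{1..p}. \<not> k \<le> card (U i)"
    using assms(1) unfolding finite_distinguishing_number_def infinite_distinguishing_number_def
    by metis
  define K where "K = 2 ^ l * Suc k"
  show ?thesis
  proof (rule that[of "2 ^ l * K + l * 2 ^ l * (K * K)" "Suc (l * 2 ^ l)" "l * K"])
    fix G assume G: "G \<in> \<C>"
    interpret graph_traces G using assms(2)[OF G] by unfold_locales
    have "card (big X (Suc k)) < l" if X: "X \<subseteq> verts G" for X
    proof (rule ccontr)
      assume *: "\<not> ?thesis"
      obtain U where U: "distinguished_by G X (card (big X (Suc k))) U"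
        "\<And>i. i \<in> {1..card (big X (Suc k))} \<Longrightarrow> Suc k \<le> card (U i)"
        using big_distinguished[OF X] by blast
      thus False using kl[OF G X _ U(1)] * by fastforce
    qed
    thus "\<exists>R \<tau> D. sparse_decomposition (2 ^ l * K + l * 2 ^ l * (K * K)) (Suc (l * 2 ^ l)) (l * K) G R \<tau> D"
      unfolding K_def by (intro sparse_decomposition_exists) auto
  qed
qed

section \<open>Long induced paths\<close>

definition has_induced_path :: "(nat \<Rightarrow> nat \<Rightarrow> bool) \<Rightarrow> nat \<Rightarrow> bool" where
  "has_induced_path E n \<longleftrightarrow> (\<exists>v. inj_on v {..<n} \<and>
     (\<forall>i<n. \<forall>j<n. E (v i) (v j) \<longleftrightarrow> j = Suc i \<or> i = Suc j))"

text \<open>A repeated vertex or a chord would shorten the walk.\<close>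

lemma shortest_walk_induced:
  assumes sym: "\<And>x y. E x y \<longleftrightarrow> E y x" and irr: "\<And>x. \<not> E x x"
    and walk: "(E ^^ k) x y" and short: "\<And>k'. k' < k \<Longrightarrow> \<not> (E ^^ k') x y"
  shows "has_induced_path E (Suc k)"
proof -
  obtain f where f: "f 0 = x" "f k = y" "\<And>i. i < k \<Longrightarrow> E (f i) (f (Suc i))"
    using walk by (auto simp: relpowp_fun_conv)
  have fwd: "(E ^^ i) x (f i)" if "i \<le> k" for i
    using that f unfolding relpowp_fun_conv by (intro exI[of _ f]) auto
  have bwd: "(E ^^ (k - i)) (f i) y" if "i \<le> k" for i
    using that f unfolding relpowp_fun_conv by (intro exI[of _ "\<lambda>j. f (i + j)"]) auto
  have ne: "f i \<noteq> f j" if "i < j" "j \<le> k" for i j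
  proof
    assume "f i = f j"
    hence "(E ^^ i) x (f j)" using fwd[of i] that by simp
    hence "(E ^^ (i + (k - j))) x y" using bwd[of j] that unfolding relpowp_add by blast
    moreover have "i + (k - j) < k" using that by linarith
    ultimately show False using short by blast
  qed
  have chord: "E (f i) (f j) \<longleftrightarrow> j = Suc i" if "i < j" "j \<le> k" for i j
  proof
    assume E: "E (f i) (f j)"
    have "(E ^^ (Suc i)) x (f j)" using fwd[of i] E that by auto
    hence "(E ^^ (Suc i + (k - j))) x y" using bwd[of j] that unfolding relpowp_add by blast
    hence "\<not> Suc i + (k - j) < k" using short by blast
    thus "j = Suc i" using that by simp
  qed (use f(3)[of i] that in simp)
  show ?thesis
    unfolding has_induced_path_def
  proof (intro exI[of _ f] conjI allI impI)
    show "inj_on f {..<Suc k}"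
      using ne by (intro linorder_inj_onI) auto
    show "E (f i) (f j) \<longleftrightarrow> j = Suc i \<or> i = Suc j" if "i < Suc k" "j < Suc k" for i j
      using chord[of i j] chord[of j i] sym[of "f i"] irr that
      by (cases i j rule: linorder_cases) auto
  qed
qed

lemma has_induced_path_mono: "has_induced_path E n \<Longrightarrow> k \<le> n \<Longrightarrow> has_induced_path E k"
  unfolding has_induced_path_def
  by (elim exE, rule_tac x = v in exI) (auto intro: inj_on_subset)

text \<open>With bounded degrees, a component without long induced paths is small, as it lies within
  bounded distance of each of its vertices.\<close>

lemma component_card_le:
  assumes sym: "\<And>x y. E x y \<longleftrightarrow> E y x" and irr: "\<And>x. \<not> E x x"
    and fin: "\<And>x. finite {y. E x y}" and deg: "\<And>x. card {y. E x y} \<le> \<Delta>"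
    and nopath: "\<not> has_induced_path E n"
  shows "finite {y. E\<^sup>*\<^sup>* x y} \<and> card {y. E\<^sup>*\<^sup>* x y} \<le> Suc \<Delta> ^ n"
proof -
  define near where "near k = {y. \<exists>j\<le>k. (E ^^ j) x y}" for k
  have near: "finite (near k) \<and> card (near k) \<le> Suc \<Delta> ^ k" for k
  proof (induction k)
    case (Suc k)
    have "near (Suc k) \<subseteq> (\<Union>y\<in>near k. insert y {z. E y z})"
    proof
      fix z assume "z \<in> near (Suc k)"
      then obtain j where j: "j \<le> Suc k" "(E ^^ j) x z" by (auto simp: near_def)
      show "z \<in> (\<Union>y\<in>near k. insert y {z. E y z})"
      proof (cases "j \<le> k")
        case True
        thus ?thesis using j by (auto simp: near_def)
      next
        case False
        hence "(E ^^ Suc k) x z" using j by (simp add: le_Suc_eq)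
        then obtain y where "(E ^^ k) x y" "E y z" by auto
        thus ?thesis by (auto simp: near_def)
      qed
    qed
    moreover have "finite (\<Union>y\<in>near k. insert y {z. E y z})" using Suc fin by auto
    moreover have "card (\<Union>y\<in>near k. insert y {z. E y z}) \<le> card (near k) * Suc \<Delta>"
      using Suc fin deg by (intro card_UN_le_mult) (auto simp: card_insert_if le_SucI)
    moreover have "card (near k) * Suc \<Delta> \<le> Suc \<Delta> ^ k * Suc \<Delta>"
      using Suc by (intro mult_le_mono1) auto
    ultimately show ?case by (metis card_mono finite_subset order_trans power_Suc2)
  qed (simp add: near_def)
  have "{y. E\<^sup>*\<^sup>* x y} \<subseteq> near n"
  proof
    fix y assume "y \<in> {y. E\<^sup>*\<^sup>* x y}"
    then obtain k0 where "(E ^^ k0) x y" using rtranclp_imp_relpowp by fast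
    then obtain k where k: "(E ^^ k) x y" "\<And>k'. k' < k \<Longrightarrow> \<not> (E ^^ k') x y"
      using exists_least_iff[of "\<lambda>k. (E ^^ k) x y"] by blast
    have "\<not> n \<le> Suc k"
      using shortest_walk_induced[OF sym irr k] has_induced_path_mono nopath by blast
    thus "y \<in> near n" using k(1) by (auto simp: near_def intro!: exI[of _ k])
  qed
  thus ?thesis using near[of n] by (meson card_mono finite_subset order_trans)
qed

section \<open>Counting graphs with small components\<close>

text \<open>Put the numbers up to \<open>k\<close> into different blocks; each of the other \<open>n - k\<close> numbers is free to join
  any of them.\<close>

lemma bell_ge:
  assumes "k \<le> n"
  shows "k ^ (n - k) \<le> bell n"
proof -
  define block where "block g j = insert j {v \<in> {Suc k..n}. g v = j}" for g :: "nat \<Rightarrow> nat" and j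
  define part where "part g = block g ` {1..k}" for g
  let ?F = "{Suc k..n} \<rightarrow>\<^sub>E {1..k}"
  have rng: "g v \<in> {1..k}" if "g \<in> ?F" "v \<in> {Suc k..n}" for g v using that by blast
  have "part g \<in> {P. partition_on {1..n} P}" if g: "g \<in> ?F" for g
  proof -
    have "v \<in> \<Union> (part g)" if "v \<in> {1..n}" for v
    proof (cases "v \<le> k")
      case True
      thus ?thesis using that by (auto simp: part_def block_def)
    next
      case False
      hence "v \<in> block g (g v)" "g v \<in> {1..k}" using rng[OF g, of v] that by (auto simp: block_def)
      thus ?thesis by (auto simp: part_def)
    qed
    moreover have "\<Union> (part g) \<subseteq> {1..n}" using assms by (auto simp: part_def block_def)
    moreover have "block g i \<inter> block g j = {}" if "i \<in> {1..k}" "j \<in> {1..k}" "i \<noteq> j" for i j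
      using that by (auto simp: block_def)
    hence "disjoint (part g)" unfolding part_def disjoint_def by blast
    moreover have "{} \<notin> part g" by (auto simp: part_def block_def)
    ultimately show ?thesis unfolding partition_on_def by blast
  qed
  moreover have "inj_on part ?F"
  proof (rule inj_onI)
    fix g h assume g: "g \<in> ?F" and h: "h \<in> ?F" and eq: "part g = part h"
    show "g = h"
    proof (rule PiE_ext[OF g h])
      fix v assume v: "v \<in> {Suc k..n}"
      have "block g (g v) \<in> part g" unfolding part_def using rng[OF g v] by (rule imageI)
      hence "block g (g v) \<in> part h" using eq by simp
      then obtain j where j: "j \<in> {1..k}" "block g (g v) = block h j" by (auto simp: part_def)
      have "v \<in> block g (g v)" "g v \<in> block g (g v)" using v by (auto simp: block_def)
      hence "v \<in> block h j" "g v \<in> block h j" using j(2) by simp_all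
      thus "g v = h v" using j(1) rng[OF g v] v by (auto simp: block_def)
    qed
  qed
  moreover have "finite {P. partition_on {1..n} P}"
    by (intro finitely_many_partition_on) simp
  ultimately have "card ?F \<le> bell n"
    unfolding bell_def by (intro card_inj_on_le[of part]) auto
  thus ?thesis by (simp add: card_PiE)
qed

text \<open>An encoding of a graph with vertex set \<open>{1..n}\<close> that has a sparse decomposition with components of
  size at most \<open>b\<close>: \<open>r\<close> lists the exceptional vertices, \<open>\<rho>\<close> maps each vertex to the root of its
  component, and \<open>dat\<close> attaches to each vertex its adjacencies to the exceptional vertices, its type,
  its position in its component, and the positions of its neighbours there.\<close>

definition decode_adj :: "nat \<Rightarrow> (nat \<Rightarrow> nat) \<Rightarrow> (nat \<times> nat) set \<Rightarrow> (nat \<Rightarrow> nat) \<Rightarrow>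
    (nat \<Rightarrow> nat set \<times> nat \<times> nat \<times> nat set) \<Rightarrow> nat \<Rightarrow> nat \<Rightarrow> bool" where
  "decode_adj c r Ds \<rho> dat x y \<longleftrightarrow>
     (if x \<in> r ` {..<c} then \<exists>i\<in>fst (dat y). r i = x
      else if y \<in> r ` {..<c} then \<exists>i\<in>fst (dat x). r i = y
      else if \<rho> x = \<rho> y then fst (snd (snd (dat y))) \<in> snd (snd (snd (dat x)))
      else (fst (snd (dat x)), fst (snd (dat y))) \<in> Ds)"

definition decode :: "nat \<Rightarrow> nat \<Rightarrow> (nat \<Rightarrow> nat) \<times> (nat \<times> nat) set \<times> (nat \<Rightarrow> nat) \<times>
    (nat \<Rightarrow> nat set \<times> nat \<times> nat \<times> nat set) \<Rightarrow> nat graph" where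
  "decode c n = (\<lambda>(r, Ds, \<rho>, dat). ({1..n},
     {{x, y} | x y. x \<in> {1..n} \<and> y \<in> {1..n} \<and> x \<noteq> y \<and> decode_adj c r Ds \<rho> dat x y}))"

text \<open>With components of size at most \<open>b\<close> there are at least \<open>n / b\<close> roots. A root map fixes its roots, and
  each fixed point saves a factor \<open>n\<close> in the count.\<close>

definition root_maps :: "nat \<Rightarrow> nat \<Rightarrow> (nat \<Rightarrow> nat) set" where
  "root_maps n s = (\<Union>S\<in>{S. S \<subseteq> {1..n} \<and> s \<le> card S}. PiE {1..n} (\<lambda>v. if v \<in> S then {v} else {1..n}))"

definition codes :: "nat \<Rightarrow> nat \<Rightarrow> nat \<Rightarrow> nat \<Rightarrow> nat \<Rightarrow> ((nat \<Rightarrow> nat) \<times> (nat \<times> nat) set \<times> (nat \<Rightarrow> nat) \<times>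
    (nat \<Rightarrow> nat set \<times> nat \<times> nat \<times> nat set)) set" where
  "codes c t b n s = ({..<c} \<rightarrow>\<^sub>E {0..n}) \<times> Pow ({..<t} \<times> {..<t}) \<times> root_maps n s \<times>
     ({1..n} \<rightarrow>\<^sub>E Pow {..<c} \<times> {..<t} \<times> {..<b} \<times> Pow {..<b})"

lemma finite_root_maps: "finite (root_maps n s)"
  unfolding root_maps_def by (intro finite_UN_I finite_PiE) auto

lemma finite_codes: "finite (codes c t b n s)"
  unfolding codes_def by (intro finite_cartesian_product finite_PiE finite_root_maps) auto

lemma card_root_maps: "card (root_maps n s) \<le> 2 ^ n * n ^ (n - s)"
proof -
  let ?I = "{S. S \<subseteq> {1..n} \<and> s \<le> card S}"
  have "card (root_maps n s) \<le> card ?I * n ^ (n - s)"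
    unfolding root_maps_def
  proof (rule card_UN_le_mult)
    fix S assume S: "S \<in> ?I"
    have fS: "finite S" using S finite_subset by auto
    have "card (PiE {1..n} (\<lambda>v. if v \<in> S then {v} else {1..n}))
        = (\<Prod>v\<in>{1..n}. card (if v \<in> S then {v} else {1..n}))"
      by (rule card_PiE) simp
    also have "\<dots> = (\<Prod>v\<in>{1..n}. if v \<in> S then 1 else n)" by (intro prod.cong) auto
    also have "\<dots> = n ^ card ({1..n} - S)"
      by (simp add: prod.If_cases Diff_eq)
    also have "card ({1..n} - S) = n - card S" using S fS by (simp add: card_Diff_subset)
    also have "n ^ (n - card S) \<le> n ^ (n - s)"
    proof (cases "n = 0")
      case False
      thus ?thesis using S by (intro power_increasing) auto
    qed (use S in simp)
    finally show "card (PiE {1..n} (\<lambda>v. if v \<in> S then {v} else {1..n})) \<le> n ^ (n - s)" .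
  qed simp
  also have "card ?I \<le> card (Pow {1..n})" by (intro card_mono) auto
  hence "card ?I * n ^ (n - s) \<le> 2 ^ n * n ^ (n - s)" by (simp add: card_Pow)
  finally show ?thesis .
qed

lemma card_codes_le:
  fixes c t b n :: nat
  assumes "1 \<le> n"
  defines "L \<equiv> 2 ^ c * 2 ^ (t * t) * 2 * (2 ^ c * (t * (b * 2 ^ b)))"
  shows "card (codes c t b n s) \<le> L ^ n * n ^ (n - s)"
proof -
  have "card (codes c t b n s) =
      Suc n ^ c * (2 ^ (t * t) * (card (root_maps n s) * (2 ^ c * (t * (b * 2 ^ b))) ^ n))"
    unfolding codes_def by (simp add: card_cartesian_product card_PiE card_Pow)
  also have "\<dots> \<le> (2 ^ c) ^ n * ((2 ^ (t * t)) ^ n * ((2 ^ n * n ^ (n - s)) * (2 ^ c * (t * (b * 2 ^ b))) ^ n))"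
  proof (intro mult_le_mono le_refl card_root_maps)
    have "Suc n \<le> 2 ^ n" by (rule Suc_leI) (rule less_exp)
    hence "Suc n ^ c \<le> (2 ^ n) ^ c" by (rule power_mono) simp
    thus "Suc n ^ c \<le> (2 ^ c) ^ n" by (simp add: power_mult[symmetric] mult.commute)
    show "(2::nat) ^ (t * t) \<le> (2 ^ (t * t)) ^ n"
      using power_increasing[of 1 n "2 ^ (t * t) :: nat"] assms(1) by simp
  qed
  also have "\<dots> = L ^ n * n ^ (n - s)"
    by (simp add: L_def power_mult_distrib mult_ac)
  finally show ?thesis .
qed

lemma labelled_subset_decode:
  assumes G: "simple_graph G" "verts G = {1..n}"
    and dec: "sparse_decomposition c t \<Delta> G R \<tau> D"
    and comp: "\<And>x. finite {y. (deviates G R \<tau> D)\<^sup>*\<^sup>* x y} \<and> card {y. (deviates G R \<tau> D)\<^sup>*\<^sup>* x y} \<le> b"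
    and n: "n = b * s"
  shows "G \<in> decode c n ` codes c t b n s"
proof -
  define E where "E = deviates G R \<tau> D"
  define C where "C x = {y. E\<^sup>*\<^sup>* x y}" for x
  have R: "R \<subseteq> {1..n}" "card R \<le> c" using dec G by (auto simp: sparse_decomposition_def)
  have fR: "finite R" using R(1) finite_subset by blast
  have C: "finite (C x)" "card (C x) \<le> b" "x \<in> C x" for x using comp by (auto simp: C_def E_def)
  have "symp E" using deviates_sym[OF dec] by (auto simp: symp_def E_def)
  hence sym: "E\<^sup>*\<^sup>* x y \<Longrightarrow> E\<^sup>*\<^sup>* y x" for x y using sympD[OF symp_rtranclp] by metis
  have C_eq: "C x = C y" if "y \<in> C x" for x y
    using that sym[of x y] by (auto simp: C_def intro: rtranclp_trans)
  have C_n: "C x \<subseteq> {1..n}" if "x \<in> {1..n}" for x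
  proof
    fix y assume "y \<in> C x"
    hence "E\<^sup>*\<^sup>* x y" by (simp add: C_def)
    thus "y \<in> {1..n}" by induction (use that G in \<open>auto simp: E_def deviates_def\<close>)
  qed
  define \<rho> where "\<rho> = restrict (\<lambda>x. Min (C x)) {1..n}"
  have Min_C: "Min (C x) \<in> C x" for x using C by (intro Min_in) auto
  have rho: "\<rho> x \<in> C x" "\<rho> x \<in> {1..n}" if "x \<in> {1..n}" for x
    using Min_C[of x] C_n[OF that] that by (auto simp: \<rho>_def)
  have rho_eq: "\<rho> x = \<rho> y \<longleftrightarrow> C x = C y" if "x \<in> {1..n}" "y \<in> {1..n}" for x y
  proof
    assume "\<rho> x = \<rho> y"
    thus "C x = C y" using C_eq[OF rho(1)[OF that(1)]] C_eq[OF rho(1)[OF that(2)]] by simp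
  qed (use that in \<open>simp add: \<rho>_def\<close>)
  define S where "S = \<rho> ` {1..n}"
  have S: "S \<subseteq> {1..n}" "s \<le> card S"
  proof -
    show "S \<subseteq> {1..n}" using rho(2) by (auto simp: S_def)
    have "x \<in> C (\<rho> x)" if "x \<in> {1..n}" for x using C_eq[OF rho(1)[OF that]] C(3)[of x] by simp
    hence "{1..n} \<subseteq> (\<Union>x\<in>S. C x)" by (auto simp: S_def)
    hence "card {1..n} \<le> card (\<Union>x\<in>S. C x)" using C by (intro card_mono) (auto simp: S_def)
    also have "\<dots> \<le> card S * b" using C by (intro card_UN_le_mult) (auto simp: S_def)
    finally have le: "b * s \<le> b * card S" using n by (simp add: mult.commute)
    have "0 < b" using C(2,3)[of 0] C(1)[of 0] by (metis card_gt_0_iff empty_iff gr0I le_0_eq)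
    thus "s \<le> card S" using le by simp
  qed
  have rho_S: "\<rho> v = v" if "v \<in> S" for v
  proof -
    obtain u where u: "u \<in> {1..n}" "v = \<rho> u" using \<open>v \<in> S\<close> by (auto simp: S_def)
    hence "\<rho> v = \<rho> u" using rho_eq[of v u] C_eq[OF rho(1)] rho(2) by simp
    thus ?thesis using u by simp
  qed
  have rho_code: "\<rho> \<in> root_maps n s"
    unfolding root_maps_def
  proof (intro UN_I[of S] CollectI conjI S PiE_I)
    show "\<rho> v \<in> (if v \<in> S then {v} else {1..n})" if "v \<in> {1..n}" for v
      using rho_S rho(2)[OF that] by auto
  qed (auto simp: \<rho>_def)
  define pos where "pos y = card {z \<in> C y. z < y}" for y
  have pos_b: "pos y < b" for y
  proof -
    have "{z \<in> C y. z < y} \<subset> C y" using C(3) by blast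
    hence "pos y < card (C y)" unfolding pos_def using C(1) by (rule psubset_card_mono[rotated])
    thus ?thesis using C(2)[of y] by simp
  qed
  have pos_less: "pos y < pos z" if "C y = C z" "y < z" for y z
  proof -
    have "{v \<in> C y. v < y} \<subset> {v \<in> C z. v < z}" using that C(3)[of y] by auto
    thus ?thesis unfolding pos_def using C(1) by (intro psubset_card_mono) auto
  qed
  have pos_inj: "y = z" if "C y = C z" "pos y = pos z" for y z
    using pos_less[of y z] pos_less[of z y] that by (cases y z rule: linorder_cases) auto
  obtain h where h: "bij_betw h {0..<card R} R" using ex_bij_betw_nat_finite[OF fR] by blast
  \<comment> \<open>The value 0 is not a vertex and fills up the list of exceptional vertices.\<close>
  define r where "r = restrict (\<lambda>i. if i < card R then h i else 0) {..<c}"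
  have r_code: "r \<in> {..<c} \<rightarrow>\<^sub>E {0..n}"
    using h R(1) by (fastforce simp: r_def bij_betw_def)
  have r_R: "x \<in> r ` {..<c} \<longleftrightarrow> x \<in> R" if "x \<in> {1..n}" for x
  proof
    assume "x \<in> r ` {..<c}"
    thus "x \<in> R" using that h by (auto simp: r_def bij_betw_def split: if_splits)
  next
    assume "x \<in> R"
    hence "x \<in> h ` {0..<card R}" using h by (simp add: bij_betw_def)
    then obtain i where "i < card R" "h i = x" by auto
    thus "x \<in> r ` {..<c}" using R(2) by (intro image_eqI[of _ _ i]) (auto simp: r_def)
  qed
  define Ds where "Ds = {(a, b). D a b}"
  have Ds_code: "Ds \<subseteq> {..<t} \<times> {..<t}" using dec by (auto simp: Ds_def sparse_decomposition_def)
  define dat where "dat = restrict (\<lambda>x. ({i \<in> {..<c}. adj G x (r i)}, \<tau> x, pos x,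
      {pos y | y. y \<in> C x \<and> adj G x y})) {1..n}"
  have dat_code: "dat \<in> {1..n} \<rightarrow>\<^sub>E Pow {..<c} \<times> {..<t} \<times> {..<b} \<times> Pow {..<b}"
    using pos_b dec by (auto simp: dat_def sparse_decomposition_def)
  have adj_dec: "decode_adj c r Ds \<rho> dat x y \<longleftrightarrow> adj G x y"
    if xy: "x \<in> {1..n}" "y \<in> {1..n}" "x \<noteq> y" for x y
  proof -
    consider "x \<in> R" | "x \<notin> R" "y \<in> R" | "x \<notin> R" "y \<notin> R" "C x = C y" | "x \<notin> R" "y \<notin> R" "C x \<noteq> C y"
      by blast
    thus ?thesis
    proof cases
      case 1
      hence "x \<in> r ` {..<c}" using r_R xy by blast
      thus ?thesis using xy by (auto simp: decode_adj_def dat_def insert_commute)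
    next
      case 2
      hence "x \<notin> r ` {..<c}" "y \<in> r ` {..<c}" using r_R xy by blast+
      thus ?thesis using xy by (auto simp: decode_adj_def dat_def)
    next
      case 3
      hence "x \<notin> r ` {..<c}" "y \<notin> r ` {..<c}" "\<rho> x = \<rho> y" using r_R rho_eq xy by blast+
      hence "decode_adj c r Ds \<rho> dat x y \<longleftrightarrow> pos y \<in> {pos z | z. z \<in> C x \<and> adj G x z}"
        using xy by (simp add: decode_adj_def dat_def)
      also have "\<dots> \<longleftrightarrow> adj G x y"
      proof
        assume "pos y \<in> {pos z | z. z \<in> C x \<and> adj G x z}"
        then obtain z where z: "pos y = pos z" "z \<in> C x" "adj G x z" by blast
        have "C y = C z" using C_eq[OF z(2)] 3 by simp
        thus "adj G x y" using pos_inj z by blast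
      next
        assume "adj G x y"
        thus "pos y \<in> {pos z | z. z \<in> C x \<and> adj G x z}" using C(3)[of y] 3 by blast
      qed
      finally show ?thesis .
    next
      case 4
      hence "x \<notin> r ` {..<c}" "y \<notin> r ` {..<c}" "\<rho> x \<noteq> \<rho> y" using r_R rho_eq xy by blast+
      hence "decode_adj c r Ds \<rho> dat x y \<longleftrightarrow> D (\<tau> x) (\<tau> y)"
        using xy by (simp add: decode_adj_def dat_def Ds_def)
      moreover have "\<not> E x y"
      proof
        assume "E x y"
        hence "y \<in> C x" by (auto simp: C_def)
        thus False using C_eq 4 by blast
      qed
      ultimately show ?thesis using 4 xy G by (auto simp: E_def deviates_def)
    qed
  qed
  have "edges G = {{x, y} | x y. x \<in> {1..n} \<and> y \<in> {1..n} \<and> x \<noteq> y \<and> adj G x y}"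
  proof (intro set_eqI iffI)
    fix e assume e: "e \<in> edges G"
    hence "e \<subseteq> {1..n}" "card e = 2" using G by (auto simp: simple_graph_def)
    then obtain x y where "e = {x, y}" "x \<noteq> y" by (auto simp: card_2_iff)
    thus "e \<in> {{x, y} | x y. x \<in> {1..n} \<and> y \<in> {1..n} \<and> x \<noteq> y \<and> adj G x y}"
      using e \<open>e \<subseteq> {1..n}\<close> by blast
  qed auto
  also have "\<dots> = {{x, y} | x y. x \<in> {1..n} \<and> y \<in> {1..n} \<and> x \<noteq> y \<and> decode_adj c r Ds \<rho> dat x y}"
    using adj_dec by blast
  finally have "G = decode c n (r, Ds, \<rho>, dat)"
    using G(2) by (cases G) (simp add: decode_def)
  moreover have "(r, Ds, \<rho>, dat) \<in> codes c t b n s"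
    using r_code Ds_code rho_code dat_code by (simp add: codes_def)
  ultimately show ?thesis by blast
qed

text \<open>The codes bound the number of graphs with \<open>n\<close> vertices by \<open>L ^ n * n ^ (n - n / b)\<close> for a constant
  \<open>L\<close>, while the Bell number is at least \<open>k ^ (n - k)\<close>. For \<open>n = 2 * b * k\<close> with \<open>k\<close> large, the second
  number wins, as it saves only half as many factors.\<close>

theorem small_components_not_above_bell:
  assumes simple: "\<And>G. G \<in> \<C> \<Longrightarrow> simple_graph G"
    and small: "\<And>G. G \<in> \<C> \<Longrightarrow> \<exists>R \<tau> D. sparse_decomposition c t \<Delta> G R \<tau> D \<and>
      (\<forall>x. finite {y. (deviates G R \<tau> D)\<^sup>*\<^sup>* x y} \<and> card {y. (deviates G R \<tau> D)\<^sup>*\<^sup>* x y} \<le> b)"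
    and "1 \<le> b"
  shows "\<not> above_bell \<C>"
proof
  assume "above_bell \<C>"
  then obtain n0 where n0: "\<And>n. n0 \<le> n \<Longrightarrow> bell n \<le> card (labelled \<C> n)"
    unfolding above_bell_def by blast
  define L where "L = 2 ^ c * 2 ^ (t * t) * 2 * (2 ^ c * (t * (b * 2 ^ b)))"
  define B where "B = 2 * b"
  define k where "k = Suc (n0 + (L * B) ^ B)"
  define n where "n = B * k"
  have B: "2 \<le> B" using \<open>1 \<le> b\<close> by (simp add: B_def)
  have "1 * k \<le> B * k" using B by (intro mult_le_mono1) simp
  hence kn: "k \<le> n" by (simp add: n_def)
  have n_eq: "n = b * (2 * k)" by (simp add: n_def B_def)
  have "1 \<le> n" "n0 \<le> n" using kn by (auto simp: k_def)
  have "labelled \<C> n \<subseteq> decode c n ` codes c t b n (2 * k)"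
  proof
    fix G assume "G \<in> labelled \<C> n"
    hence G: "G \<in> \<C>" "verts G = {1..n}" by (auto simp: labelled_def)
    obtain R \<tau> D where "sparse_decomposition c t \<Delta> G R \<tau> D"
      "\<And>x. finite {y. (deviates G R \<tau> D)\<^sup>*\<^sup>* x y} \<and> card {y. (deviates G R \<tau> D)\<^sup>*\<^sup>* x y} \<le> b"
      using small[OF G(1)] by blast
    thus "G \<in> decode c n ` codes c t b n (2 * k)"
      by (rule labelled_subset_decode[OF simple[OF G(1)] G(2) _ _ n_eq])
  qed
  hence "card (labelled \<C> n) \<le> card (decode c n ` codes c t b n (2 * k))"
    by (intro card_mono finite_imageI finite_codes)
  also have "\<dots> \<le> card (codes c t b n (2 * k))" by (rule card_image_le[OF finite_codes])
  also have "\<dots> \<le> L ^ n * n ^ (n - 2 * k)"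
    unfolding L_def by (rule card_codes_le[OF \<open>1 \<le> n\<close>])
  also have "n - 2 * k = (B - 2) * k" by (simp add: n_def diff_mult_distrib)
  also have "L ^ n * n ^ ((B - 2) * k) = L ^ n * B ^ ((B - 2) * k) * k ^ ((B - 2) * k)"
    by (simp add: n_def power_mult_distrib)
  also have "\<dots> \<le> L ^ n * B ^ n * k ^ ((B - 2) * k)"
  proof (intro mult_le_mono le_refl)
    show "B ^ ((B - 2) * k) \<le> B ^ n"
      using B by (intro power_increasing) (auto simp: n_def)
  qed
  also have "L ^ n * B ^ n = ((L * B) ^ B) ^ k"
    by (simp add: n_def power_mult[symmetric] power_mult_distrib)
  also have "((L * B) ^ B) ^ k * k ^ ((B - 2) * k) < k ^ k * k ^ ((B - 2) * k)"
  proof (rule mult_strict_right_mono)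
    show "((L * B) ^ B) ^ k < k ^ k" by (rule power_strict_mono) (auto simp: k_def)
  qed (simp add: k_def)
  also have "k ^ k * k ^ ((B - 2) * k) = k ^ (n - k)"
  proof -
    have "B = Suc (Suc (B - 2))" using B by simp
    hence "n = k + (k + (B - 2) * k)" unfolding n_def by (metis mult_Suc)
    thus ?thesis by (simp add: power_add)
  qed
  also have "\<dots> \<le> bell n" by (rule bell_ge[OF kn])
  finally show False using n0[OF \<open>n0 \<le> n\<close>] by simp
qed

section \<open>Repeated words in classes above the Bell numbers\<close>

lemma uniform_choice:
  assumes "finite S" "\<And>q::nat. \<exists>s\<in>S. P s q" "\<And>s q q'. P s q' \<Longrightarrow> q \<le> q' \<Longrightarrow> P s q"
  shows "\<exists>s\<in>S. \<forall>q. P s q"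
proof (rule ccontr)
  assume "\<not> ?thesis"
  then obtain g where g: "\<And>s. s \<in> S \<Longrightarrow> \<not> P s (g s)" by metis
  obtain s where s: "s \<in> S" "P s (Max (g ` S))" using assms(2) by blast
  have "g s \<le> Max (g ` S)" using assms(1) s(1) by simp
  thus False using g[OF s(1)] assms(3)[OF s(2)] by blast
qed

text \<open>A long induced path in the sparsification reads as a long word. Cut into windows, it contains
  many copies of one window, and one vertex is left out between consecutive windows.\<close>

lemma induced_path_copies:
  assumes dec: "sparse_decomposition c t \<Delta> G R \<tau> D"
    and path: "has_induced_path (deviates G R \<tau> D) (q * t ^ N * Suc N)"
    and "2 \<le> q * t ^ N * Suc N"
  shows "\<exists>u\<in>{..<N} \<rightarrow>\<^sub>E {..<t}. embeds ({..<q} \<times> {..<N}) (copies_adj D u) (verts G) (adj G)"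
proof -
  define n where "n = q * t ^ N * Suc N"
  obtain v where v: "inj_on v {..<n}"
    "\<And>i j. i < n \<Longrightarrow> j < n \<Longrightarrow> deviates G R \<tau> D (v i) (v j) \<longleftrightarrow> j = Suc i \<or> i = Suc j"
    using path unfolding has_induced_path_def n_def by blast
  have "2 \<le> n" using assms(3) by (simp add: n_def)
  \<comment> \<open>Each vertex of the path has a neighbour on it, and only unexceptional vertices have one.\<close>
  have vG: "v i \<in> verts G - R" if "i < n" for i
  proof (cases "Suc i < n")
    case True
    thus ?thesis using v(2)[of i "Suc i"] that by (simp add: deviates_def)
  next
    case False
    hence "0 < i" "i - 1 < n" "i = Suc (i - 1)" using that \<open>2 \<le> n\<close> by auto
    thus ?thesis using v(2)[of i "i - 1"] that by (simp add: deviates_def)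
  qed
  have adj_v: "adj G (v i) (v j) \<longleftrightarrow> (j = Suc i \<or> i = Suc j) \<noteq> D (\<tau> (v i)) (\<tau> (v j))"
    if "i < n" "j < n" "i \<noteq> j" for i j
  proof -
    have "v i \<noteq> v j" using v(1) that by (auto dest: inj_onD)
    thus ?thesis using v(2)[OF that(1,2)] vG[OF that(1)] vG[OF that(2)]
      unfolding deviates_def by blast
  qed
  define win where "win r = restrict (\<lambda>i. \<tau> (v (r * Suc N + i))) {..<N}" for r
  let ?W = "{..<N} \<rightarrow>\<^sub>E {..<t}" and ?B = "{..<q * t ^ N}"
  have "win \<in> ?B \<rightarrow> ?W" using dec by (auto simp: win_def sparse_decomposition_def)
  moreover have "card ?W = t ^ N" by (simp add: card_PiE)
  moreover have "t \<noteq> 0" using dec by (auto simp: sparse_decomposition_def)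
  hence "?W \<noteq> {}" by (auto simp: PiE_eq_empty_iff)
  ultimately obtain u where u: "u \<in> ?W" "q * t ^ N \<le> card (win -` {u} \<inter> ?B) * t ^ N"
    using pigeonhole_card[of win ?B ?W] by (auto simp: finite_PiE)
  hence "q \<le> card (win -` {u} \<inter> ?B)" using \<open>t \<noteq> 0\<close> by simp
  then obtain S where S: "S \<subseteq> win -` {u} \<inter> ?B" "card S = q" "finite S"
    using obtain_subset_with_card_n by metis
  obtain h where h: "bij_betw h {0..<q} S" using ex_bij_betw_nat_finite[OF S(3)] S(2) by blast
  define \<phi> where "\<phi> = (\<lambda>(r, i). h r * Suc N + i)"
  have hS: "win (h r) = u" "h r < q * t ^ N" if "r < q" for r
  proof -
    have "h r \<in> S" using h that by (auto simp: bij_betw_def)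
    thus "win (h r) = u" "h r < q * t ^ N" using S(1) by auto
  qed
  have \<phi>n: "\<phi> x < n" if "x \<in> {..<q} \<times> {..<N}" for x
  proof -
    obtain r i where x: "x = (r, i)" "r < q" "i < N"
      using \<open>x \<in> {..<q} \<times> {..<N}\<close> by auto
    have "h r * Suc N + i < Suc (h r) * Suc N" using x by simp
    also have "\<dots> \<le> q * t ^ N * Suc N" using hS(2)[OF x(2)] by (intro mult_le_mono1) simp
    finally show ?thesis using x by (simp add: \<phi>_def n_def)
  qed
  have dm: "(a * Suc N + i) div Suc N = a" "(a * Suc N + i) mod Suc N = i" if "i \<le> N" for a i
    using that by (simp_all del: mult_Suc_right)
  have hinj: "r = s" if "h r = h s" "r < q" "s < q" for r s
    using h that by (auto simp: bij_betw_def dest: inj_onD)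
  have \<phi>inj: "x = y" if "x \<in> {..<q} \<times> {..<N}" "y \<in> {..<q} \<times> {..<N}" "\<phi> x = \<phi> y" for x y
  proof -
    obtain r i s j where x: "x = (r, i)" "r < q" "i < N" "y = (s, j)" "s < q" "j < N"
      using \<open>x \<in> {..<q} \<times> {..<N}\<close> \<open>y \<in> {..<q} \<times> {..<N}\<close> by auto
    hence eq: "h r * Suc N + i = h s * Suc N + j" using that(3) by (simp add: \<phi>_def)
    have "h r = h s" "i = j" using dm[of i "h r"] dm[of j "h s"] x eq by auto
    thus ?thesis using hinj x by simp
  qed
  have \<phi>Suc: "\<phi> y = Suc (\<phi> x) \<longleftrightarrow> fst x = fst y \<and> snd y = Suc (snd x)"
    if "x \<in> {..<q} \<times> {..<N}" "y \<in> {..<q} \<times> {..<N}" for x y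
  proof -
    obtain r i s j where x: "x = (r, i)" "r < q" "i < N" "y = (s, j)" "s < q" "j < N"
      using \<open>x \<in> {..<q} \<times> {..<N}\<close> \<open>y \<in> {..<q} \<times> {..<N}\<close> by auto
    have "h s = h r \<and> j = Suc i" if eq: "h s * Suc N + j = h r * Suc N + Suc i"
      using dm[of "Suc i" "h r"] dm[of j "h s"] x eq by auto
    thus ?thesis using hinj x by (auto simp: \<phi>_def)
  qed
  have \<phi>u: "\<tau> (v (\<phi> x)) = u (snd x)" if x: "x \<in> {..<q} \<times> {..<N}" for x
  proof -
    obtain r i where x: "x = (r, i)" "r < q" "i < N"
      using \<open>x \<in> {..<q} \<times> {..<N}\<close> by auto
    have "win (h r) i = \<tau> (v (\<phi> x))" using x by (simp add: win_def \<phi>_def)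
    thus ?thesis using hS(1) x by simp
  qed
  have "embeds ({..<q} \<times> {..<N}) (copies_adj D u) (verts G) (adj G)"
  proof (rule embedsI[of "v \<circ> \<phi>"])
    show "inj_on (v \<circ> \<phi>) ({..<q} \<times> {..<N})"
    proof (rule comp_inj_on)
      show "inj_on \<phi> ({..<q} \<times> {..<N})" using \<phi>inj by (intro inj_onI)
      show "inj_on v (\<phi> ` ({..<q} \<times> {..<N}))" using v(1) by (rule inj_on_subset) (use \<phi>n in auto)
    qed
    fix x assume x: "x \<in> {..<q} \<times> {..<N}"
    show "(v \<circ> \<phi>) x \<in> verts G" using vG[OF \<phi>n[OF x]] by simp
    fix y assume y: "y \<in> {..<q} \<times> {..<N}" "x \<noteq> y"
    have "\<phi> x \<noteq> \<phi> y" using \<phi>inj[OF x y(1)] y(2) by blast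
    from adj_v[OF \<phi>n[OF x] \<phi>n[OF y(1)] this]
    show "copies_adj D u x y = adj G ((v \<circ> \<phi>) x) ((v \<circ> \<phi>) y)"
      using \<phi>Suc[OF x y(1)] \<phi>Suc[OF y(1) x] \<phi>u[OF x] \<phi>u[OF y(1)]
      by (auto simp: copies_adj_def)
  qed
  thus ?thesis using u(1) by blast
qed

text \<open>Above the Bell numbers, the sparsifications cannot all have small components, so they contain
  induced paths of any length. The adjacency on the types and the repeated window range over a
  finite set, so one choice of both serves all numbers of copies.\<close>

theorem above_bell_has_copies:
  assumes "finite_distinguishing_number \<C>" "above_bell \<C>" "\<And>G. G \<in> \<C> \<Longrightarrow> simple_graph G"
  obtains D :: "nat \<Rightarrow> nat \<Rightarrow> bool" and u where "\<And>a b. D a b \<longleftrightarrow> D b a" "has_copies \<C> D u N"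
proof -
  obtain c t \<Delta> where dec: "\<And>G. G \<in> \<C> \<Longrightarrow> \<exists>R \<tau> D. sparse_decomposition c t \<Delta> G R \<tau> D"
    using finite_distinguishing_sparse_decomposition[OF assms(1,3)] by metis
  have path: "\<exists>G\<in>\<C>. \<exists>R \<tau> D. sparse_decomposition c t \<Delta> G R \<tau> D \<and> has_induced_path (deviates G R \<tau> D) n"
    for n
  proof (rule ccontr)
    assume no: "\<not> ?thesis"
    have small: "\<exists>R \<tau> D. sparse_decomposition c t \<Delta> G R \<tau> D \<and>
      (\<forall>x. finite {y. (deviates G R \<tau> D)\<^sup>*\<^sup>* x y} \<and>
           card {y. (deviates G R \<tau> D)\<^sup>*\<^sup>* x y} \<le> Suc \<Delta> ^ n)" if G: "G \<in> \<C>" for G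
    proof -
      obtain R \<tau> D where d: "sparse_decomposition c t \<Delta> G R \<tau> D" using dec[OF G] by blast
      have np: "\<not> has_induced_path (deviates G R \<tau> D) n" using no G d by blast
      have "finite (verts G)" using assms(3)[OF G] by (simp add: simple_graph_def)
      hence fin: "finite {y. deviates G R \<tau> D x y}" for x
        by (rule rev_finite_subset) (auto simp: deviates_def)
      have deg: "card {y. deviates G R \<tau> D x y} \<le> \<Delta>" for x
        using d by (simp add: sparse_decomposition_def)
      have irr: "\<not> deviates G R \<tau> D x x" for x by (simp add: deviates_def)
      show ?thesis
        using d component_card_le[OF deviates_sym[OF d] irr fin deg np] by blast
    qed
    have "\<not> above_bell \<C>"
      by (rule small_components_not_above_bell[OF assms(3) small one_le_power]) simp_all
    thus False using assms(2) by blast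
  qed
  define Ds where "Ds = {d \<in> Pow ({..<t} \<times> {..<t}). sym d}"
  define good where "good = (\<lambda>(d :: (nat \<times> nat) set, u) q. \<exists>G\<in>\<C>.
    embeds ({..<q} \<times> {..<N}) (copies_adj (\<lambda>a b. (a, b) \<in> d) u) (verts G) (adj G))"
  have "\<exists>x\<in>Ds \<times> ({..<N} \<rightarrow>\<^sub>E {..<t}). \<forall>q. good x q"
  proof (rule uniform_choice)
    show "finite (Ds \<times> ({..<N} \<rightarrow>\<^sub>E {..<t}))" by (auto simp: Ds_def intro: finite_PiE)
  next
    fix x q q' assume g: "good x q'" and "q \<le> q'"
    obtain d u where x: "x = (d, u)" by (cases x)
    have "embeds ({..<q} \<times> {..<N}) (copies_adj (\<lambda>a b. (a, b) \<in> d) u)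
        ({..<q'} \<times> {..<N}) (copies_adj (\<lambda>a b. (a, b) \<in> d) u)"
      by (rule embedsI[of "\<lambda>x. x"]) (use \<open>q \<le> q'\<close> in auto)
    thus "good x q" using g embeds_trans unfolding good_def x by (auto, blast)
  next
    fix q :: nat
    \<comment> \<open>Two additional copies make sure that the path has an edge.\<close>
    let ?q = "q + 2"
    obtain G R \<tau> D where G: "G \<in> \<C>" and d: "sparse_decomposition c t \<Delta> G R \<tau> D"
      and p: "has_induced_path (deviates G R \<tau> D) (?q * t ^ N * Suc N)"
      using path by blast
    have "0 < t" using d by (auto simp: sparse_decomposition_def)
    hence "1 \<le> t ^ N" "1 \<le> Suc N" by simp_all
    hence "2 * 1 * 1 \<le> ?q * t ^ N * Suc N" by (intro mult_le_mono) auto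
    then obtain u where u: "u \<in> {..<N} \<rightarrow>\<^sub>E {..<t}"
      "embeds ({..<?q} \<times> {..<N}) (copies_adj D u) (verts G) (adj G)"
      using induced_path_copies[OF d p] by auto
    have "embeds ({..<q} \<times> {..<N}) (copies_adj D u) ({..<?q} \<times> {..<N}) (copies_adj D u)"
      by (rule embedsI[of "\<lambda>x. x"]) auto
    hence "embeds ({..<q} \<times> {..<N}) (copies_adj D u) (verts G) (adj G)"
      using u(2) embeds_trans by blast
    moreover have "{(a, b). D a b} \<in> Ds"
      using d by (auto simp: Ds_def sym_def sparse_decomposition_def)
    ultimately show "\<exists>x\<in>Ds \<times> ({..<N} \<rightarrow>\<^sub>E {..<t}). good x q"
      using u(1) G by (intro bexI[of _ "({(a, b). D a b}, u)"]) (auto simp: good_def)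
  qed
  then obtain d u where d: "d \<in> Ds" "\<And>q. good (d, u) q" by blast
  show ?thesis
  proof (rule that[of "\<lambda>a b. (a, b) \<in> d" u])
    show "(a, b) \<in> d \<longleftrightarrow> (b, a) \<in> d" for a b using d(1) by (auto simp: Ds_def sym_def)
    show "has_copies \<C> (\<lambda>a b. (a, b) \<in> d) u N"
      using d(2) by (simp add: has_copies_def good_def)
  qed
qed

text \<open>Forbidding a graph with at most one vertex leaves no graph with vertices, whereas Bell numbers are
  positive. So the maximal order \<open>m\<close> of a forbidden graph is at least 2, and the patterns in question have at least three indices, which
  makes the comatchings among them connected.\<close>

lemma above_bell_Free_forbidden_card:
  assumes "above_bell (Free \<F>)" "F \<in> \<F>" "simple_graph F"
  shows "2 \<le> card (verts F)"
proof (rule ccontr)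
  assume "\<not> 2 \<le> card (verts F)"
  hence le: "card (verts F) \<le> 1" by simp
  have fF: "finite (verts F)" using assms(3) by (simp add: simple_graph_def)
  have "labelled (Free \<F>) n = {}" if "1 \<le> n" for n
  proof (rule ccontr)
    assume "labelled (Free \<F>) n \<noteq> {}"
    then obtain G where G: "G \<in> Free \<F>" "verts G = {1..n}" by (auto simp: labelled_def)
    have one: "x = y" if "x \<in> verts F" "y \<in> verts F" for x y
      using le fF that by (metis card_le_Suc0_iff_eq One_nat_def)
    have "embeds (verts F) (adj F) (verts G) (adj G)"
    proof (rule embedsI[of "\<lambda>_. 1"])
      show "inj_on (\<lambda>_. 1::nat) (verts F)" using one by (intro inj_onI)
      show "1 \<in> verts G" using G(2) that by simp
      show "adj F x y = adj G 1 1" if "x \<in> verts F" "y \<in> verts F" "x \<noteq> y" for x y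
        using one that by blast
    qed
    moreover have "simple_graph G" using G(1) by (simp add: Free_def)
    ultimately have "contains_induced G F" using contains_induced_iff_embeds assms(3) by blast
    thus False using G(1) assms(2) by (simp add: Free_def)
  qed
  moreover obtain N where N: "1 \<le> N" "\<And>n. N \<le> n \<Longrightarrow> bell n \<le> card (labelled (Free \<F>) n)"
    using assms(1) unfolding above_bell_def by blast
  ultimately have "bell N = 0" using N(2)[of N] by simp
  moreover have "1 ^ (N - 1) \<le> bell N" using bell_ge[OF N(1)] by simp
  ultimately show False by simp
qed

section \<open>Existence of a periodic word\<close>

theorem theorem5p7:
  fixes f :: "nat \<Rightarrow> nat \<Rightarrow> nat \<Rightarrow> nat"
    and Gs :: "nat graph list"
    and \<C> :: "nat graph set"
    and m M l :: nat
  assumes "unavoidable_bound f"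
    and "Gs \<noteq> []"
    and "\<forall>G\<in>set Gs. simple_graph G"
    and "\<C> = Free (set Gs)"
    and "m = Max ((\<lambda>G. card (verts G)) ` set Gs)"
    and "M = ramsey4 (2 * m - 1)"
    and "l = f M M M"
    and "finite_distinguishing_number \<C>"
    and "above_bell \<C>"
  shows "\<exists>(H :: nat graph) (w :: nat \<Rightarrow> nat) p.
    loop_graph H \<and> word_over w (verts H) \<and> card (letters w) \<le> l \<and>
    has_period w p \<and> p \<le> l ^ m + 1 \<and>
    word_class w H \<subseteq> \<C>"
proof -
  have small: "\<forall>F\<in>set Gs. simple_graph F \<and> card (verts F) \<le> m"
    using assms(3,5) by auto
  have "hd Gs \<in> set Gs" using assms(2) by simp
  hence m2: "2 \<le> m"
    using above_bell_Free_forbidden_card[of "set Gs" "hd Gs"] assms(3,4,9) small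
    by (meson order_trans)
  have simple: "simple_graph G" if "G \<in> \<C>" for G using that assms(4) by (simp add: Free_def)
  \<comment> \<open>A word of this length has \<open>l ^ m + 1\<close> factors of length \<open>m\<close>.\<close>
  define N where "N = l ^ m + m"
  obtain D :: "nat \<Rightarrow> nat \<Rightarrow> bool" and u0 where
    sym: "\<And>a b. D a b \<longleftrightarrow> D b a" and "has_copies \<C> D u0 N"
    using above_bell_has_copies[OF assms(8,9) simple] by metis
  then obtain u where copies: "has_copies (Free (set Gs)) D u N"
    and twins: "inj_on (\<lambda>a. {b \<in> u ` {..<N}. D a b}) (u ` {..<N})"
    using has_copies_merge_twins[of \<C> D u0 N] assms(4) by metis
  define A where "A = u ` {..<N}"
  have cA: "card A \<le> l"
    using card_letters_le[OF small m2 assms(1,6) _ copies sym twins] assms(4,7,8)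
    by (simp add: A_def)
  have fA: "finite A" by (simp add: A_def)
  \<comment> \<open>Two of the factors at the positions up to \<open>l ^ m\<close> coincide, and their distance is the period.\<close>
  define fac where "fac i = restrict (\<lambda>s. u (i + s)) {..<m}" for i
  have "fac ` {..l ^ m} \<subseteq> {..<m} \<rightarrow>\<^sub>E A"
    by (auto simp: fac_def A_def N_def split: if_splits)
  hence "card (fac ` {..l ^ m}) \<le> card ({..<m} \<rightarrow>\<^sub>E A)"
    using fA by (intro card_mono finite_PiE) auto
  also have "\<dots> = card A ^ m" by (simp add: card_PiE)
  also have "\<dots> \<le> l ^ m" using cA by (rule power_mono) simp
  finally have "\<not> inj_on fac {..l ^ m}" by (intro pigeonhole) simp
  then obtain i j where ij: "i < j" "j \<le> l ^ m" "fac i = fac j"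
    unfolding inj_on_def by (metis atMost_iff linorder_neqE_nat)
  have eq: "u (i + s) = u (j + s)" if "s < m" for s
    using fun_cong[OF ij(3), of s] that by (simp add: fac_def)
  define H where "H = (A, {{a, b} | a b. a \<in> A \<and> b \<in> A \<and> D a b})"
  define w where "w t = u (i + t mod (j - i))" for t
  have wA: "w t \<in> A" for t
  proof -
    have "t mod (j - i) < j - i" using ij by simp
    hence "i + t mod (j - i) < N" using ij m2 unfolding N_def by linarith
    thus ?thesis by (auto simp: w_def A_def)
  qed
  have "card {a, b} \<in> {1, 2}" for a b :: nat by (cases "a = b") auto
  hence "loop_graph H" using fA by (auto simp: loop_graph_def H_def)
  moreover have "word_over w (verts H)" using wA by (simp add: word_over_def H_def)
  moreover have "card (letters w) \<le> l"
  proof -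
    have "letters w \<subseteq> A" using wA by (auto simp: letters_def)
    from card_mono[OF fA this] cA show ?thesis by (rule order_trans)
  qed
  moreover have "w t = w (t + (j - i))" for t by (simp only: w_def mod_add_self2)
  hence "has_period w (j - i)" using ij by (auto simp: has_period_def)
  moreover have "j - i \<le> l ^ m + 1" using ij by simp
  moreover have "word_class w H \<subseteq> \<C>"
    using periodic_word_class_subset[OF small copies sym ij(1) _ eq] ij
    unfolding assms(4) H_def A_def w_def N_def by simp
  ultimately show ?thesis by blast
qed

end
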